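(* Consider the Stackelberg game, the assumptions (A1), (A2), (A3)(1b), and the two-loop algorithm described in the context. Suppose (A1), (A2) and (A3)(1b) hold. Set $\eta_t=\bar\eta\,(t+1)^{-1/2}d^{-1}$ and $\delta_t=\bar\delta\,(t+1)^{-1/4}d^{-1/2}$, where $\bar\eta,\bar\delta>0$ and $\bar\eta\le d/(2\tilde\ell)$. Additionally, set $K\ge\frac{1}{|\log\rho|}\left(\frac12\log T+2\log d\right)$. Then the iterates of the algorithm satisfy $$\min_{t\in[T]}\mathbb{E}\big[\|\nabla\tilde f(x_t)\|^2\big]\le\tilde O\left(\frac{d}{\sqrt T}\right).$$
   Context: **Game.** Let $X=\mathbb{R}^d$, let $Y\subset\mathbb{R}^{d'}$ be convex and compact, and let $f:X\times Y\to\mathbb{R}$ and $G:X\times Y\to\mathbb{R}^{d'}$ be twice continuously differentiable. For $x\in X$ let $S(x)=\{y\in Y:\langle y'-y,G(x,y)\rangle\ge 0\ \forall y'\in Y\}$ be the solution set of the variational inequality. The Stackelberg game is $\min_{x\in X,y\in Y}f(x,y)$ subject to $y\in S(x)$. Under the singleton assumption below, $S(x)$ is identified with its unique element, and the hyper-objective is $\tilde f(x)=f(x,S(x))$, so the problem is $\min_{x\in X}\tilde f(x)$. A function $h$ is $L$-Lipschitz if $\|h(x)-h(x')\|\le L\|x-x'\|$ for all $x,x'$, and $\ell$-smooth if $\|\nabla h(x)-\nabla h(x')\|\le\ell\|x-x'\|$ for all $x,x'$. **(A1)** (1) For every $y\in Y$, $f(\cdot,y)$ is $L_x$-Lipschitz;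 for every $x\in X$, $f(x,\cdot)$ is $L_y$-Lipschitz and $\ell_y$-smooth. (2) For every $x\in X$, $S(x)$ is a singleton, and $x\mapsto S(x)$ is $L_S$-Lipschitz. (3) $\tilde f$ is twice continuously differentiable, $\tilde L$-Lipschitz and $\tilde\ell$-smooth. **Follower updates.** For $x\in X$ and an initialization $y^{(0)}\in Y$, followers iterate $y^{(k+1)}(x)=H_k(y^{(k)}(x);x)$, $k=0,\dots,K-1$, where $H_k$ is the given update map of an iterative solver and $K$ is a positive integer. **(A2)** There is $C>0$ such that for any $x,\hat x\in X$, the follower updates started from the same initialization satisfy $\|y^{(K)}(x)-y^{(K)}(\hat x)\|\le C\|x-\hat x\|$. **(A3)(1b)** There are a positive scalar $C$ and $\rho\in[0,1)$ such that for every $x\in X$ and every initial point $y^{(0)}\in Y$ (and every number $K$ of steps), $\|y^{(K)}(x)-S(x)\|\le C\rho^K\|y^{(0)}-S(x)\|$. **Algorithm.** Input: horizon $T$, $K$, initial $x_0\in X$, $y_0^{(0)},\tilde y_0^{(0)}\in Y$, step sizes $(\eta_t)$, perturbation radii $(\delta_t)$. For $t=0,1,\dots,T-1$: sample $v_t$ uniformly (independently of the past) from the unit sphere $\{z\in\mathbb{R}^d:\|z\|_2=1\}$; set $\hat x_t=x_t+\delta_tv_t$; for $k=0,\dots,K-1$ set $\tilde y_t^{(k+1)}=H_k(\tilde y_t^{(k)};x_t)$ and $y_t^{(k+1)}=H_k(y_t^{(k)};\hat x_t)$; set $x_{t+1}=x_t-\eta_t\frac{d}{\delta_t}\big(f(\hat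 x_t,y_t^{(K)})-f(x_t,\tilde y_t^{(K)})\big)v_t$; set $y_{t+1}^{(0)}=\tilde y_{t+1}^{(0)}=\tilde y_t^{(K)}$. **Notation.** $[T]=\{0,1,\dots,T\}$. $\tilde O(\cdot)$ hides factors logarithmic in $T$ and constants not depending on $T$, $d$, $K$.
   Formalization: The hyper-objective is additionally assumed bounded below, with the gap between its value at x_0 and its infimum entering the hidden constant (for linear f̃ the claim fails); the update maps H_k are taken to map Y to Y and to be Borel so that the expectations exist. *)

theory Defs
  imports "HOL-Probability.Probability"
begin

text \<open>
  The order of the bound in the dimension $d$ is part of the claim, so its constant has to be chosen
  before $d$. A dimension carried by a type cannot be quantified inside a formula, hence
  $\mathbb{R}^d$ is realised as the subspace \<open>euc d\<close> of one inner product space: the finitely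
  supported real sequences with the Euclidean norm.
\<close>

typedef fseq = "{x :: nat \<Rightarrow> real. finite {i. x i \<noteq> 0}}"
  morphisms coord Abs_fseq
  by (rule exI[of _ "\<lambda>_. 0"]) simp

setup_lifting type_definition_fseq

lemma finite_supp: "finite {i. coord x i \<noteq> 0}"
  using coord[of x] by simp

lemma fseq_eqI: "(\<And>i. coord x i = coord y i) \<Longrightarrow> x = y"
  by (metis coord_inject ext)

instantiation fseq :: real_inner
begin

lift_definition zero_fseq :: fseq is "\<lambda>_. 0" by simp
lift_definition plus_fseq :: "fseq \<Rightarrow> fseq \<Rightarrow> fseq" is "\<lambda>x y i. x i + y i"
  subgoal for x y by (rule finite_subset[of _ "{i. x i \<noteq> 0} \<union> {i. y i \<noteq> 0}"]) auto
  done
lift_definition minus_fseq :: "fseq \<Rightarrow> fseq \<Rightarrow> fseq" is "\<lambda>x y i. x i - y i"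
  subgoal for x y by (rule finite_subset[of _ "{i. x i \<noteq> 0} \<union> {i. y i \<noteq> 0}"]) auto
  done
lift_definition uminus_fseq :: "fseq \<Rightarrow> fseq" is "\<lambda>x i. - x i" by simp
lift_definition scaleR_fseq :: "real \<Rightarrow> fseq \<Rightarrow> fseq" is "\<lambda>a x i. a * x i"
  by (auto elim: rev_finite_subset)

definition inner_fseq :: "fseq \<Rightarrow> fseq \<Rightarrow> real" where
  "inner_fseq x y = (\<Sum>i\<in>{i. coord x i \<noteq> 0}. coord x i * coord y i)"
definition norm_fseq :: "fseq \<Rightarrow> real" where
  "norm_fseq x = sqrt (inner x x)"
definition dist_fseq :: "fseq \<Rightarrow> fseq \<Rightarrow> real" where
  "dist_fseq x y = norm (x - y)"
definition sgn_fseq :: "fseq \<Rightarrow> fseq" where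
  "sgn_fseq x = inverse (norm x) *\<^sub>R x"
definition uniformity_fseq :: "(fseq \<times> fseq) filter" where
  "uniformity_fseq = (INF e\<in>{0<..}. principal {(x, y). dist x y < e})"
definition open_fseq :: "fseq set \<Rightarrow> bool" where
  "open_fseq U \<longleftrightarrow> (\<forall>x\<in>U. \<forall>\<^sub>F (x', y) in uniformity. x' = x \<longrightarrow> y \<in> U)"

lemma inner_fseq_superset:
  assumes "finite A" "{i. coord x i \<noteq> 0} \<subseteq> A"
  shows "inner x y = (\<Sum>i\<in>A. coord x i * coord y i)"
  unfolding inner_fseq_def using assms by (intro sum.mono_neutral_left) auto

instance
proof
  fix x y z :: fseq and r s :: real
  let ?A = "{i. coord x i \<noteq> 0} \<union> {i. coord y i \<noteq> 0}"
  have A: "finite ?A" by (simp add: finite_supp)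
  show "inner x y = inner y x"
    using inner_fseq_superset[OF A, of x y] inner_fseq_superset[OF A, of y x]
    by (simp add: mult.commute)
  have "inner (x + y) z = (\<Sum>i\<in>?A. coord (x + y) i * coord z i)"
    by (intro inner_fseq_superset[OF A]) (auto simp: plus_fseq.rep_eq)
  then show "inner (x + y) z = inner x z + inner y z"
    using inner_fseq_superset[OF A, of x z] inner_fseq_superset[OF A, of y z]
    by (simp add: plus_fseq.rep_eq algebra_simps sum.distrib)
  have "inner (r *\<^sub>R x) y = (\<Sum>i\<in>?A. coord (r *\<^sub>R x) i * coord y i)"
    by (intro inner_fseq_superset[OF A]) (auto simp: scaleR_fseq.rep_eq)
  then show "inner (r *\<^sub>R x) y = r * inner x y"
    using inner_fseq_superset[OF A, of x y]
    by (simp add: scaleR_fseq.rep_eq sum_distrib_left mult.assoc)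
  show "0 \<le> inner x x"
    unfolding inner_fseq_def by (intro sum_nonneg) simp
  show "inner x x = 0 \<longleftrightarrow> x = 0"
  proof
    assume "inner x x = 0"
    then have "\<forall>i\<in>{i. coord x i \<noteq> 0}. coord x i * coord x i = 0"
      unfolding inner_fseq_def using finite_supp by (subst (asm) sum_nonneg_eq_0_iff) auto
    then show "x = 0"
      by (intro fseq_eqI) (auto simp: zero_fseq.rep_eq)
  qed (simp add: inner_fseq_def zero_fseq.rep_eq)
qed (auto intro!: fseq_eqI simp: plus_fseq.rep_eq minus_fseq.rep_eq uminus_fseq.rep_eq
       scaleR_fseq.rep_eq zero_fseq.rep_eq algebra_simps norm_fseq_def dist_fseq_def sgn_fseq_def
       uniformity_fseq_def open_fseq_def)

end

definition euc :: "nat \<Rightarrow> fseq set" where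
  "euc d = {x. \<forall>i\<ge>d. coord x i = 0}"

text \<open>Agrees with \<open>z\<close> below \<open>d\<close> and vanishes from \<open>d\<close> on.\<close>
lift_definition fseq_of :: "nat \<Rightarrow> (nat \<Rightarrow> real) \<Rightarrow> fseq" is "\<lambda>d z i. if i < d then z i else 0"
  by (rule finite_subset[of _ "{..<_}"]) auto

text \<open>
  The uniform distribution on the unit sphere of \<open>euc d\<close>, for \<open>d \<ge> 1\<close>, i.e. normalised surface
  measure, as the cone measure: the radial projection of a point drawn uniformly (w.r.t. Lebesgue
  measure) from the unit ball. The origin, where \<open>sgn\<close> is \<open>0\<close>, is a null set. The restriction
  makes the sphere the underlying space, so that nothing depends on values off \<open>euc d\<close>.
\<close>
definition unif_sphere :: "nat \<Rightarrow> fseq measure" where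
  "unif_sphere d =
     restrict_space
       (distr (uniform_measure (\<Pi>\<^sub>M i\<in>{..<d}. lborel)
                {z \<in> space (\<Pi>\<^sub>M i\<in>{..<d}. lborel). L2_set z {..<d} \<le> 1})
         borel (\<lambda>z. sgn (fseq_of d z)))
       (sphere 0 1 \<inter> euc d)"

text \<open>
  Twice continuous differentiability of \<open>h\<close> on a subset \<open>S\<close> of a finite-dimensional subspace \<open>V\<close>:
  \<open>h\<close> extends to a $C^2$ function on a relatively open neighbourhood of \<open>S\<close> in \<open>V\<close>. As \<open>V\<close> is
  finite-dimensional, differentiability and continuity of the derivatives may be expressed
  direction by direction.
\<close>
definition C2_on ::
  "'a::real_normed_vector set \<Rightarrow> 'a set \<Rightarrow> ('a \<Rightarrow> 'b::real_normed_vector) \<Rightarrow> bool" where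
  "C2_on V S h \<longleftrightarrow>
     (\<exists>U g D1 D2. open U \<and> S \<subseteq> U \<inter> V \<and> (\<forall>z\<in>S. g z = h z) \<and>
        (\<forall>z\<in>U \<inter> V. (g has_derivative D1 z) (at z within V)) \<and>
        (\<forall>u\<in>V. \<forall>z\<in>U \<inter> V. ((\<lambda>w. D1 w u) has_derivative D2 u z) (at z within V)) \<and>
        (\<forall>u\<in>V. \<forall>w\<in>V. continuous_on (U \<inter> V) (\<lambda>z. D2 u z w)))"

definition smooth_on :: "real \<Rightarrow> 'a::real_inner set \<Rightarrow> ('a \<Rightarrow> real) \<Rightarrow> bool" where
  "smooth_on l S h \<longleftrightarrow>
     (\<exists>g. (\<forall>z\<in>S. (h has_derivative inner (g z)) (at z within S)) \<and> l-lipschitz_on S g)"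

definition grad :: "nat \<Rightarrow> (fseq \<Rightarrow> real) \<Rightarrow> fseq \<Rightarrow> fseq" where
  "grad d h x = (THE g. g \<in> euc d \<and> (h has_derivative inner g) (at x within euc d))"

definition VI_set :: "(real^'m) set \<Rightarrow> (fseq \<Rightarrow> real^'m \<Rightarrow> real^'m) \<Rightarrow> fseq \<Rightarrow> (real^'m) set" where
  "VI_set Y G x = {y \<in> Y. \<forall>y'\<in>Y. (y' - y) \<bullet> G x y \<ge> 0}"

definition sol :: "(real^'m) set \<Rightarrow> (fseq \<Rightarrow> real^'m \<Rightarrow> real^'m) \<Rightarrow> fseq \<Rightarrow> real^'m" where
  "sol Y G x = the_elem (VI_set Y G x)"

definition hyper ::
  "(real^'m) set \<Rightarrow> (fseq \<Rightarrow> real^'m \<Rightarrow> real) \<Rightarrow> (fseq \<Rightarrow> real^'m \<Rightarrow> real^'m) \<Rightarrow> fseq \<Rightarrow> real" where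
  "hyper Y f G x = f x (sol Y G x)"

definition smooth_game ::
  "nat \<Rightarrow> (real^'m) set \<Rightarrow> (fseq \<Rightarrow> real^'m \<Rightarrow> real) \<Rightarrow> (fseq \<Rightarrow> real^'m \<Rightarrow> real^'m) \<Rightarrow> bool" where
  "smooth_game d Y f G \<longleftrightarrow>
     C2_on (euc d \<times> UNIV) (euc d \<times> Y) (\<lambda>(x, y). f x y) \<and>
     C2_on (euc d \<times> UNIV) (euc d \<times> Y) (\<lambda>(x, y). G x y)"

text \<open>\<open>Lh\<close> and \<open>lh\<close> are the Lipschitz and smoothness constants of the hyper-objective.\<close>
definition A1 ::
  "nat \<Rightarrow> (real^'m) set \<Rightarrow> (fseq \<Rightarrow> real^'m \<Rightarrow> real) \<Rightarrow> (fseq \<Rightarrow> real^'m \<Rightarrow> real^'m) \<Rightarrow>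
   real \<Rightarrow> real \<Rightarrow> real \<Rightarrow> real \<Rightarrow> real \<Rightarrow> real \<Rightarrow> bool" where
  "A1 d Y f G Lx Ly ly LS Lh lh \<longleftrightarrow>
     (\<forall>y\<in>Y. Lx-lipschitz_on (euc d) (\<lambda>x. f x y)) \<and>
     (\<forall>x\<in>euc d. Ly-lipschitz_on Y (f x) \<and> smooth_on ly Y (f x)) \<and>
     (\<forall>x\<in>euc d. is_singleton (VI_set Y G x)) \<and>
     LS-lipschitz_on (euc d) (sol Y G) \<and>
     C2_on (euc d) (euc d) (hyper Y f G) \<and>
     Lh-lipschitz_on (euc d) (hyper Y f G) \<and>
     smooth_on lh (euc d) (hyper Y f G)"

text \<open>
  The update maps send \<open>Y\<close> to itself (\<open>f\<close> lives on \<open>euc d \<times> Y\<close> only) and are jointly Borel, so that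
  the iterates of the algorithm are random variables.
\<close>
definition update_maps ::
  "nat \<Rightarrow> (real^'m) set \<Rightarrow> (nat \<Rightarrow> real^'m \<Rightarrow> fseq \<Rightarrow> real^'m) \<Rightarrow> bool" where
  "update_maps d Y H \<longleftrightarrow>
     (\<forall>k. (\<forall>y\<in>Y. \<forall>x\<in>euc d. H k y x \<in> Y) \<and>
          (\<lambda>(y, x). H k y x) \<in> borel_measurable (restrict_space borel (Y \<times> euc d)))"

primrec follower ::
  "(nat \<Rightarrow> real^'m \<Rightarrow> fseq \<Rightarrow> real^'m) \<Rightarrow> fseq \<Rightarrow> real^'m \<Rightarrow> nat \<Rightarrow> real^'m" where
  "follower H x y 0 = y"
| "follower H x y (Suc k) = H k (follower H x y k) x"

definition A2 ::
  "nat \<Rightarrow> (real^'m) set \<Rightarrow> (nat \<Rightarrow> real^'m \<Rightarrow> fseq \<Rightarrow> real^'m) \<Rightarrow> nat \<Rightarrow> real \<Rightarrow> bool" where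
  "A2 d Y H K C \<longleftrightarrow>
     (\<forall>y\<in>Y. \<forall>x\<in>euc d. \<forall>x'\<in>euc d.
        norm (follower H x y K - follower H x' y K) \<le> C * norm (x - x'))"

definition A3_1b ::
  "nat \<Rightarrow> (real^'m) set \<Rightarrow> (fseq \<Rightarrow> real^'m \<Rightarrow> real^'m) \<Rightarrow>
   (nat \<Rightarrow> real^'m \<Rightarrow> fseq \<Rightarrow> real^'m) \<Rightarrow> real \<Rightarrow> real \<Rightarrow> bool" where
  "A3_1b d Y G H C \<rho> \<longleftrightarrow>
     (\<forall>x\<in>euc d. \<forall>y\<in>Y. \<forall>k.
        norm (follower H x y k - sol Y G x) \<le> C * \<rho> ^ k * norm (y - sol Y G x))"

text \<open>
  State after \<open>t\<close> rounds with sampled directions \<open>v\<close>: the leader's point and the initialisations of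
  the followers' loops at the perturbed and at the unperturbed point. The latter two may differ
  only for \<open>t = 0\<close>.
\<close>
primrec run ::
  "nat \<Rightarrow> nat \<Rightarrow> (fseq \<Rightarrow> real^'m \<Rightarrow> real) \<Rightarrow> (nat \<Rightarrow> real^'m \<Rightarrow> fseq \<Rightarrow> real^'m) \<Rightarrow>
   (nat \<Rightarrow> real) \<Rightarrow> (nat \<Rightarrow> real) \<Rightarrow> fseq \<Rightarrow> real^'m \<Rightarrow> real^'m \<Rightarrow>
   (nat \<Rightarrow> fseq) \<Rightarrow> nat \<Rightarrow> fseq \<times> (real^'m) \<times> (real^'m)" where
  "run d K f H \<eta> \<delta> x0 y0 yt0 v 0 = (x0, y0, yt0)"
| "run d K f H \<eta> \<delta> x0 y0 yt0 v (Suc t) =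
     (let (x, y, yt) = run d K f H \<eta> \<delta> x0 y0 yt0 v t;
          xh = x + \<delta> t *\<^sub>R v t;
          yK = follower H xh y K;
          ytK = follower H x yt K
      in (x - (\<eta> t * (real d / \<delta> t) * (f xh yK - f x ytK)) *\<^sub>R v t, ytK, ytK))"

definition iterate ::
  "nat \<Rightarrow> nat \<Rightarrow> (fseq \<Rightarrow> real^'m \<Rightarrow> real) \<Rightarrow> (nat \<Rightarrow> real^'m \<Rightarrow> fseq \<Rightarrow> real^'m) \<Rightarrow>
   (nat \<Rightarrow> real) \<Rightarrow> (nat \<Rightarrow> real) \<Rightarrow> fseq \<Rightarrow> real^'m \<Rightarrow> real^'m \<Rightarrow> (nat \<Rightarrow> fseq) \<Rightarrow> nat \<Rightarrow> fseq" where
  "iterate d K f H \<eta> \<delta> x0 y0 yt0 v t = fst (run d K f H \<eta> \<delta> x0 y0 yt0 v t)"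

text \<open>Joint law of the directions sampled over a horizon of \<open>T\<close> rounds.\<close>
definition directions :: "nat \<Rightarrow> nat \<Rightarrow> (nat \<Rightarrow> fseq) measure" where
  "directions d T = (\<Pi>\<^sub>M t\<in>{..<T}. unif_sphere d)"

end

theory Submission
  imports Defs
begin

text \<open>
  Write \<open>F\<close> for the hyper-objective, \<open>a\<close> for its gradient at the current point \<open>x\<close>, and \<open>v\<close>
  for the sampled direction. The proof is a descent argument along every single path of the
  algorithm; probability enters only in its last step.

  \<^item> The algorithm observes a difference of leader payoffs at approximate follower responses. As
    \<open>Y\<close> is bounded, the solver ends within \<open>C\<^sub>3 * \<rho> ^ K\<close> times the diameter of \<open>Y\<close> of the
    true response, whatever initial point it inherits from the preceding round. So the observed
    difference is the true one, \<open>F (x + \<delta> v) - F x\<close>, up to some \<open>\<epsilon>\<close> of order \<open>\<rho> ^ K\<close>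
    (\<open>follower_value_error\<close>), and the bound on \<open>K\<close> makes \<open>\<rho> ^ K\<close> at most
    \<open>1 / (sqrt T * d\<^sup>2)\<close> (\<open>contraction_power_le\<close>).

  \<^item> As \<open>F\<close> is smooth, the true difference is \<open>\<delta> * inner a v\<close> up to order \<open>\<delta>\<^sup>2\<close>. The update
    is thus \<open>- \<eta> * d * (inner a v + \<tau>)\<close> times \<open>v\<close> with \<open>\<tau>\<close> of order \<open>\<delta> + \<epsilon> / \<delta>\<close>. Half of
    the gain \<open>\<eta> * d * (inner a v)\<^sup>2\<close> absorbs the cross term with \<open>\<tau>\<close>; and since \<open>F\<close> is
    Lipschitz, the length of the update is at most of order \<open>\<eta> * d\<close>. Hence \<open>F\<close> decreases by
    \<open>\<eta> * d * (inner a v)\<^sup>2 / 2\<close>, up to errors of order \<open>\<eta> * d * (\<delta> + \<epsilon> / \<delta>)\<^sup>2 + (\<eta> * d)\<^sup>2\<close>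
    (\<open>zeroth_order_descent\<close>).

  \<^item> These decreases telescope. In expectation \<open>d * (inner a v)\<^sup>2\<close> becomes \<open>(norm a)\<^sup>2\<close>, because
    \<open>v\<close> is independent of \<open>a\<close> and the uniform distribution on the sphere is isotropic
    (\<open>integral_inner_sq_unif_sphere\<close>, \<open>expected_grad_sq\<close>). So the sum of the
    expected squared gradients, weighted by the step sizes, is at most a constant plus the sum of the
    errors (\<open>sum_expected_grad_sq_le\<close>).

  \<^item> For the step sizes at hand the errors of round \<open>t\<close> are of order \<open>1 / (t + 1)\<close>, with a constant
    that depends neither on \<open>d\<close> nor on \<open>T\<close> (\<open>descent_remainder_le\<close>), so they add up to one
    logarithm, whereas the step sizes add up to at least \<open>\<eta>b * sqrt T / d\<close>. A minimum is at most a
    weighted average, and the quotient is the claimed bound, with exponent \<open>p = 1\<close>.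
\<close>

section \<open>Finitely supported sequences as a separable space\<close>

lemma coord_zero [simp]: "coord 0 i = 0"
  and coord_add [simp]: "coord (x + y) i = coord x i + coord y i"
  and coord_diff [simp]: "coord (x - y) i = coord x i - coord y i"
  and coord_scaleR [simp]: "coord (a *\<^sub>R x) i = a * coord x i"
  by (simp_all add: zero_fseq.rep_eq plus_fseq.rep_eq minus_fseq.rep_eq scaleR_fseq.rep_eq)

lemma coord_sum [simp]: "coord (sum h A) i = (\<Sum>a\<in>A. coord (h a) i)"
  by (induction A rule: infinite_finite_induct) auto

lemma coord_fseq_of [simp]: "coord (fseq_of d z) i = (if i < d then z i else 0)"
  by (simp add: fseq_of.rep_eq)

lemma subspace_euc: "subspace (euc d)"
  by (auto simp: subspace_def euc_def)

lemma fseq_of_in_euc [simp]: "fseq_of d z \<in> euc d"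
  by (simp add: euc_def)

lemma ex_euc: "\<exists>d. x \<in> euc d"
proof -
  obtain d where "{i. coord x i \<noteq> 0} \<subseteq> {..<d}"
    using finite_supp finite_nat_iff_bounded by blast
  then show ?thesis
    by (intro exI[of _ d]) (auto simp: euc_def)
qed

lemma inner_euc: "x \<in> euc d \<Longrightarrow> inner x y = (\<Sum>i<d. coord x i * coord y i)"
  by (rule inner_fseq_superset) (auto simp: euc_def linorder_not_le[symmetric])

lemma norm_euc: "x \<in> euc d \<Longrightarrow> norm x = L2_set (coord x) {..<d}"
  by (simp add: norm_eq_sqrt_inner inner_euc L2_set_def power2_eq_square)

text \<open>
  Separability of the sequence space makes its Borel sets compatible with sums and products of
  measurable maps, on which the measurability of the algorithm rests.
\<close>
lemma dense_rational_fseq: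
  assumes "e > 0"
  shows "\<exists>qs. dist x (fseq_of (length qs) (\<lambda>i. real_of_rat (qs ! i))) < e"
proof -
  obtain d where d: "x \<in> euc d"
    using ex_euc by blast
  have "\<exists>q. \<bar>coord x i - real_of_rat q\<bar> < e / (real d + 1)" for i
  proof -
    have "coord x i < coord x i + e / (real d + 1)"
      using assms by simp
    then obtain q where "coord x i < real_of_rat q" "real_of_rat q < coord x i + e / (real d + 1)"
      using of_rat_dense by blast
    then show ?thesis
      by (intro exI[of _ q]) auto
  qed
  then obtain q where q: "\<And>i. \<bar>coord x i - real_of_rat (q i)\<bar> < e / (real d + 1)"
    by metis
  let ?y = "fseq_of (length (map q [0..<d])) (\<lambda>i. real_of_rat (map q [0..<d] ! i))"
  have mem: "x - ?y \<in> euc d"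
    using d by (auto simp: euc_def)
  have "dist x ?y \<le> (\<Sum>i<d. \<bar>coord (x - ?y) i\<bar>)"
    unfolding dist_norm norm_euc[OF mem] by (rule L2_set_le_sum_abs)
  also have "\<dots> \<le> (\<Sum>i<d. e / (real d + 1))"
    using q by (intro sum_mono less_imp_le) auto
  also have "\<dots> < e"
    using assms by (simp add: field_simps)
  finally show ?thesis
    by blast
qed

instance fseq :: second_countable_topology
proof
  let ?c = "\<lambda>qs. fseq_of (length qs) (\<lambda>i. real_of_rat (qs ! i))"
  let ?B = "(\<lambda>(qs, n). ball (?c qs) (1 / real (Suc n))) ` (UNIV :: (rat list \<times> nat) set)"
  have "topological_basis ?B"
  proof (rule topological_basisI)
    fix U :: "fseq set" and x
    assume "open U" "x \<in> U"
    then obtain e where e: "e > 0" "ball x e \<subseteq> U"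
      using open_contains_ball by blast
    then obtain n where n: "1 / real (Suc n) < e / 2"
      using nat_approx_posE[of "e / 2"] by auto
    obtain qs where qs: "dist x (?c qs) < 1 / real (Suc n)"
      using dense_rational_fseq[of "1 / real (Suc n)" x] by auto
    have "ball (?c qs) (1 / real (Suc n)) \<subseteq> ball x e"
    proof
      fix y
      assume "y \<in> ball (?c qs) (1 / real (Suc n))"
      then show "y \<in> ball x e"
        using dist_triangle[of x y "?c qs"] qs n by simp
    qed
    moreover have "x \<in> ball (?c qs) (1 / real (Suc n))"
      using qs by (simp add: dist_commute)
    ultimately show "\<exists>B'\<in>?B. x \<in> B' \<and> B' \<subseteq> U"
      using e by (intro bexI[of _ "ball (?c qs) (1 / real (Suc n))"]) auto
  qed auto
  moreover have "countable ?B"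
    by simp
  ultimately show "\<exists>B::fseq set set. countable B \<and> open = generate_topology B"
    using topological_basis_imp_subbasis by blast
qed

definition unit_seq :: "nat \<Rightarrow> fseq" where
  "unit_seq i = fseq_of (Suc i) (\<lambda>j. if j = i then 1 else 0)"

lemma coord_unit_seq [simp]: "coord (unit_seq i) j = (if j = i then 1 else 0)"
  by (auto simp: unit_seq_def)

lemma coord_eq_inner: "coord x i = inner (unit_seq i) x"
  by (subst inner_euc[of _ "Suc i"]) (auto simp: unit_seq_def)

lemma abs_coord_le_norm: "\<bar>coord x i\<bar> \<le> norm x"
proof -
  have "inner (unit_seq i) (unit_seq i) = 1"
    by (simp flip: coord_eq_inner)
  then have "norm (unit_seq i) = 1"
    by (simp add: norm_eq_sqrt_inner)
  then show ?thesis
    using Cauchy_Schwarz_ineq2[of "unit_seq i" x] by (simp add: coord_eq_inner)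
qed

lemma fseq_of_eq_sum: "fseq_of d z = (\<Sum>i<d. z i *\<^sub>R unit_seq i)"
  by (intro fseq_eqI) (auto simp: mult_delta_right)

lemma measurable_fseq_of [measurable]:
  "fseq_of d \<in> borel_measurable (\<Pi>\<^sub>M i\<in>{..<d}. lborel)"
proof -
  have "(\<lambda>z. \<Sum>i<d. z i *\<^sub>R unit_seq i) \<in> borel_measurable (\<Pi>\<^sub>M i\<in>{..<d}. lborel)"
    by measurable
  then show ?thesis
    by (simp add: fseq_of_eq_sum[symmetric])
qed

lemma measurable_coord [measurable]: "(\<lambda>x. coord x i) \<in> borel_measurable borel"
  by (simp add: coord_eq_inner)

lemma closed_euc: "closed (euc d)"
proof -
  have "euc d = (\<Inter>i\<in>{d..}. {x. coord x i = 0})"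
    by (auto simp: euc_def)
  moreover have "closed {x. coord x i = 0}" for i
    unfolding coord_eq_inner by (intro closed_Collect_eq continuous_intros)
  ultimately show ?thesis
    by auto
qed

section \<open>Isotropy of the uniform distribution on the sphere\<close>

text \<open>
  The uniform distribution on the unit ball of coordinate vectors, whose radial projection defines
  \<^const>\<open>unif_sphere\<close>.
\<close>
abbreviation ball_unif :: "nat \<Rightarrow> (nat \<Rightarrow> real) measure" where
  "ball_unif d \<equiv> uniform_measure (\<Pi>\<^sub>M i\<in>{..<d}. lborel)
     {z \<in> space (\<Pi>\<^sub>M i\<in>{..<d}. lborel). L2_set z {..<d} \<le> 1}"

lemma unit_ball_sets [measurable]:
  "{z \<in> space (\<Pi>\<^sub>M i\<in>{..<d}. lborel). L2_set z {..<d} \<le> 1} \<in> sets (\<Pi>\<^sub>M i\<in>{..<d}. lborel)"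
  unfolding L2_set_def by measurable

lemma emeasure_unit_ball:
  "emeasure (\<Pi>\<^sub>M i\<in>{..<d}. lborel) {z \<in> space (\<Pi>\<^sub>M i\<in>{..<d}. lborel). L2_set z {..<d} \<le> 1}
     = ennreal (unit_ball_vol (real d))"
  using emeasure_cball_aux[of "{..<d}" 1]
  by (simp add: L2_set_def Int_def conj_commute)

lemma prob_space_ball_unif: "prob_space (ball_unif d)"
  by (rule prob_space_uniform_measure)
    (simp_all add: emeasure_unit_ball ennreal_eq_0_iff not_le)

lemma L2_set_signed_involution:
  fixes \<sigma> :: "nat \<Rightarrow> nat" and s :: "nat \<Rightarrow> real"
  assumes \<sigma>: "\<And>i. i < d \<Longrightarrow> \<sigma> i < d" "\<And>i. i < d \<Longrightarrow> \<sigma> (\<sigma> i) = i"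
    and s: "\<And>i. s i = 1 \<or> s i = -1"
  shows "L2_set (\<lambda>i\<in>{..<d}. s i * z (\<sigma> i)) {..<d} = L2_set z {..<d}"
proof -
  have "(s i * x)\<^sup>2 = x\<^sup>2" for i x
    using s[of i] by auto
  then have "(\<Sum>i<d. ((\<lambda>i\<in>{..<d}. s i * z (\<sigma> i)) i)\<^sup>2) = (\<Sum>i<d. (z (\<sigma> i))\<^sup>2)"
    by simp
  also have "\<dots> = (\<Sum>i<d. (z i)\<^sup>2)"
    by (rule sum.reindex_bij_witness[of _ \<sigma> \<sigma>]) (use \<sigma> in auto)
  finally show ?thesis
    by (simp add: L2_set_def)
qed

text \<open>
  Sign changes and transpositions of coordinates are symmetries enough for isotropy: the
  former make the coordinates of a uniform direction uncorrelated, the latter give them equal second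
  moments. Both are signed involutions of the coordinates, and these preserve Lebesgue measure because
  they map boxes to boxes of equal volume.
\<close>
lemma distr_PiM_lborel_signed_involution:
  fixes \<sigma> :: "nat \<Rightarrow> nat" and s :: "nat \<Rightarrow> real"
  assumes \<sigma>: "\<And>i. i < d \<Longrightarrow> \<sigma> i < d" "\<And>i. i < d \<Longrightarrow> \<sigma> (\<sigma> i) = i"
    and s: "\<And>i. s i = 1 \<or> s i = -1"
  defines "M \<equiv> (\<Pi>\<^sub>M i\<in>{..<d}. (lborel :: real measure))"
  defines "h \<equiv> (\<lambda>z. \<lambda>i\<in>{..<d}. s i * z (\<sigma> i))"
  shows "h \<in> measurable M M" and "distr M M h = M"
proof -
  interpret product_sigma_finite "\<lambda>_::nat. lborel :: real measure"
    by standard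
  show h [measurable]: "h \<in> measurable M M"
    unfolding h_def M_def by (rule measurable_restrict) (use \<sigma> in simp)
  have "distr M M h = (\<Pi>\<^sub>M i\<in>{..<d}. (lborel :: real measure))"
  proof (rule PiM_eqI)
    fix A :: "nat \<Rightarrow> real set"
    assume A: "\<And>i. i \<in> {..<d} \<Longrightarrow> A i \<in> sets lborel"
    have pre: "h -` Pi\<^sub>E {..<d} A \<inter> space M =
        Pi\<^sub>E {..<d} (\<lambda>j. (\<lambda>x. s (\<sigma> j) * x) -` A (\<sigma> j))" (is "?L = ?R")
    proof (intro equalityI subsetI)
      fix z
      assume z: "z \<in> ?L"
      then have mem: "s i * z (\<sigma> i) \<in> A i" if "i < d" for i
        using that by (auto simp: h_def PiE_iff restrict_def)
      then have "s (\<sigma> j) * z j \<in> A (\<sigma> j)" if "j < d" for j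
        using \<sigma> that by metis
      then show "z \<in> ?R"
        using z by (auto simp: M_def space_PiM PiE_iff)
    next
      fix z
      assume z: "z \<in> ?R"
      then have mem: "s (\<sigma> j) * z j \<in> A (\<sigma> j)" if "j < d" for j
        using that by (auto simp: PiE_iff)
      then have "s i * z (\<sigma> i) \<in> A i" if "i < d" for i
        using \<sigma> that by metis
      then show "z \<in> ?L"
        using z by (auto simp: M_def h_def space_PiM PiE_iff)
    qed
    have flip: "emeasure lborel ((\<lambda>x. s i * x) -` A i) = emeasure lborel (A i)"
      and flip_sets: "(\<lambda>x. s i * x) -` A i \<in> sets lborel" if "i < d" for i
    proof -
      have Ai: "A i \<in> sets borel"
        using A that by simp
      show "(\<lambda>x. s i * x) -` A i \<in> sets lborel"
        using measurable_sets[of "\<lambda>x. s i * x" borel borel "A i"] Ai by simp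
      show "emeasure lborel ((\<lambda>x. s i * x) -` A i) = emeasure lborel (A i)"
        using s[of i]
      proof
        assume m: "s i = -1"
        have "emeasure lborel (A i) = emeasure (distr lborel borel uminus) (A i)"
          by (simp add: lborel_distr_uminus)
        also have "\<dots> = emeasure lborel (uminus -` A i)"
          using Ai by (subst emeasure_distr) auto
        finally show ?thesis
          using m by simp
      qed simp
    qed
    have "emeasure (distr M M h) (Pi\<^sub>E {..<d} A)
        = emeasure M (Pi\<^sub>E {..<d} (\<lambda>j. (\<lambda>x. s (\<sigma> j) * x) -` A (\<sigma> j)))"
      unfolding pre[symmetric] using A
      by (intro emeasure_distr[OF h]) (auto simp: M_def intro!: sets_PiM_I_finite)
    also have "\<dots> = (\<Prod>j<d. emeasure lborel ((\<lambda>x. s (\<sigma> j) * x) -` A (\<sigma> j)))"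
      unfolding M_def by (intro emeasure_PiM) (use \<sigma> flip_sets in auto)
    also have "\<dots> = (\<Prod>j<d. emeasure lborel (A (\<sigma> j)))"
      using \<sigma> flip by (intro prod.cong) auto
    also have "\<dots> = (\<Prod>i<d. emeasure lborel (A i))"
      by (rule prod.reindex_bij_witness[of _ \<sigma> \<sigma>]) (use \<sigma> in auto)
    finally show "emeasure (distr M M h) (Pi\<^sub>E {..<d} A) = (\<Prod>i<d. emeasure lborel (A i))" .
  qed (simp_all add: M_def)
  then show "distr M M h = M"
    by (simp add: M_def)
qed

lemma integral_ball_unif_signed_involution:
  fixes \<sigma> :: "nat \<Rightarrow> nat" and s :: "nat \<Rightarrow> real" and g :: "(nat \<Rightarrow> real) \<Rightarrow> real"
  assumes \<sigma>: "\<And>i. i < d \<Longrightarrow> \<sigma> i < d" "\<And>i. i < d \<Longrightarrow> \<sigma> (\<sigma> i) = i"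
    and s: "\<And>i. s i = 1 \<or> s i = -1"
    and g: "g \<in> borel_measurable (\<Pi>\<^sub>M i\<in>{..<d}. lborel)"
  shows "(\<integral>z. g (\<lambda>i\<in>{..<d}. s i * z (\<sigma> i)) \<partial>ball_unif d) = (\<integral>z. g z \<partial>ball_unif d)"
proof -
  define M where "M = (\<Pi>\<^sub>M i\<in>{..<d}. (lborel :: real measure))"
  define B where "B = {z \<in> space M. L2_set z {..<d} \<le> 1}"
  define h where "h = (\<lambda>z. \<lambda>i\<in>{..<d}. s i * z (\<sigma> i))"
  have h [measurable]: "h \<in> measurable M M" and inv: "distr M M h = M"
    using distr_PiM_lborel_signed_involution[of d \<sigma> s, OF \<sigma> s] by (simp_all add: M_def h_def)
  have B [measurable]: "B \<in> sets M"
    unfolding B_def M_def by measurable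
  have L2: "L2_set (h z) {..<d} = L2_set z {..<d}" for z
    unfolding h_def by (rule L2_set_signed_involution[OF \<sigma> s])
  have "distr (uniform_measure M B) (uniform_measure M B) h = uniform_measure M B"
  proof (rule measure_eqI)
    fix X
    assume "X \<in> sets (distr (uniform_measure M B) (uniform_measure M B) h)"
    then have X [measurable]: "X \<in> sets M"
      by simp
    have "h -` X \<inter> space M \<in> sets M"
      by measurable
    then have "emeasure (distr (uniform_measure M B) (uniform_measure M B) h) X
        = emeasure M (B \<inter> (h -` X \<inter> space M)) / emeasure M B"
      by (subst emeasure_distr) auto
    also have "B \<inter> (h -` X \<inter> space M) = h -` (B \<inter> X) \<inter> space M"
      using measurable_space[OF h] L2 by (auto simp: B_def)
    also have "emeasure M \<dots> = emeasure (distr M M h) (B \<inter> X)"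
      by (subst emeasure_distr) auto
    finally show "emeasure (distr (uniform_measure M B) (uniform_measure M B) h) X
        = emeasure (uniform_measure M B) X"
      by (simp add: inv)
  qed simp
  then have "(\<integral>z. g z \<partial>uniform_measure M B)
      = (\<integral>z. g z \<partial>distr (uniform_measure M B) (uniform_measure M B) h)"
    by simp
  also have "\<dots> = (\<integral>z. g (h z) \<partial>uniform_measure M B)"
    by (rule integral_distr) (use g in \<open>simp_all add: M_def[symmetric]\<close>)
  finally show ?thesis
    by (simp add: M_def B_def h_def)
qed

text \<open>
  The only point of the ball that does not project to the sphere is the origin. It is a null set
  because \<open>d \<ge> 1\<close>; for \<open>d = 0\<close> it is the whole space.
\<close>
lemma AE_ball_unif_sgn:
  assumes "d \<ge> 1"
  shows "AE z in ball_unif d. sgn (fseq_of d z) \<in> sphere 0 1 \<inter> euc d"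
proof -
  interpret product_sigma_finite "\<lambda>_::nat. lborel :: real measure"
    by standard
  let ?M = "\<Pi>\<^sub>M i\<in>{..<d}. (lborel :: real measure)"
  have "emeasure ?M (Pi\<^sub>E {..<d} (\<lambda>_. {0})) = 0"
    using assms by (subst emeasure_PiM) (auto simp: prod_zero_iff intro: exI[of _ 0])
  then have "Pi\<^sub>E {..<d} (\<lambda>_. {0}) \<in> null_sets ?M"
    by (intro null_setsI sets_PiM_I_finite) auto
  moreover have "{z \<in> space ?M. sgn (fseq_of d z) \<notin> sphere 0 1 \<inter> euc d} \<subseteq> Pi\<^sub>E {..<d} (\<lambda>_. {0})"
  proof clarify
    fix z
    assume z: "z \<in> space ?M" "sgn (fseq_of d z) \<notin> sphere 0 1 \<inter> euc d"
    have "sgn (fseq_of d z) \<in> euc d"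
      unfolding sgn_div_norm by (intro subspace_scale[OF subspace_euc]) simp
    with z have "fseq_of d z = 0"
      by (auto simp: norm_sgn split: if_splits)
    then have "coord (fseq_of d z) i = 0" for i
      by simp
    then have "z i = 0" if "i < d" for i
      using that by (metis coord_fseq_of)
    then show "z \<in> Pi\<^sub>E {..<d} (\<lambda>_. {0})"
      using z by (intro PiE_I) (auto simp: space_PiM PiE_iff extensional_def)
  qed
  ultimately have "AE z in ?M. sgn (fseq_of d z) \<in> sphere 0 1 \<inter> euc d"
    by (rule AE_I')
  then show ?thesis
    by (intro AE_uniform_measureI) auto
qed

lemma measurable_sgn_fseq_of [measurable]:
  "(\<lambda>z. sgn (fseq_of d z)) \<in> borel_measurable (\<Pi>\<^sub>M i\<in>{..<d}. lborel)"
  unfolding sgn_div_norm by measurable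

lemma coord_sgn_fseq_of:
  "i < d \<Longrightarrow> coord (sgn (fseq_of d z)) i = z i / L2_set z {..<d}"
  by (simp add: sgn_div_norm norm_euc[OF fseq_of_in_euc] divide_inverse cong: L2_set_cong_simp)

lemma integrable_coord_sgn_mult:
  "integrable (ball_unif d) (\<lambda>z. coord (sgn (fseq_of d z)) i * coord (sgn (fseq_of d z)) j)"
proof -
  interpret prob_space "ball_unif d"
    by (rule prob_space_ball_unif)
  have "\<bar>coord (sgn (fseq_of d z)) i\<bar> \<le> 1" for z i
    using abs_coord_le_norm[of "sgn (fseq_of d z)" i] by (auto simp: norm_sgn split: if_splits)
  then show ?thesis
    by (intro integrable_const_bound[where B = 1]) (auto simp: abs_mult intro!: mult_le_one)
qed

text \<open>
  Off the diagonal, flipping the sign of one coordinate turns the moment into its negative. On the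
  diagonal, transpositions show that all \<open>d\<close> moments agree, and they add up to the expected squared
  norm, which is \<open>1\<close>.
\<close>
lemma second_moments_ball_unif:
  assumes "i < d" "j < d"
  shows "(\<integral>z. coord (sgn (fseq_of d z)) i * coord (sgn (fseq_of d z)) j \<partial>ball_unif d)
           = (if i = j then 1 / real d else 0)"
proof -
  define w where "w z i = coord (sgn (fseq_of d z)) i" for z i
  interpret prob_space "ball_unif d"
    by (rule prob_space_ball_unif)
  have meas [measurable]: "(\<lambda>z. w z i) \<in> borel_measurable (\<Pi>\<^sub>M i\<in>{..<d}. lborel)" for i
    unfolding w_def by measurable
  have int: "integrable (ball_unif d) (\<lambda>z. w z i * w z j)" for i j
    unfolding w_def by (rule integrable_coord_sgn_mult)
  have w_signed: "w (\<lambda>i\<in>{..<d}. s i * z (\<sigma> i)) k = s k * w z (\<sigma> k)"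
    if "k < d" "\<And>i. i < d \<Longrightarrow> \<sigma> i < d" "\<And>i. i < d \<Longrightarrow> \<sigma> (\<sigma> i) = i" "\<And>i. s i = 1 \<or> s i = -1"
    for s \<sigma> z k
    using that by (simp add: w_def coord_sgn_fseq_of L2_set_signed_involution[where \<sigma> = \<sigma> and s = s])
  show ?thesis
  proof (cases "i = j")
    case False
    define s :: "nat \<Rightarrow> real" where "s k = (if k = i then -1 else 1)" for k
    have "(\<integral>z. w (\<lambda>i\<in>{..<d}. s i * z (id i)) i * w (\<lambda>i\<in>{..<d}. s i * z (id i)) j \<partial>ball_unif d)
        = (\<integral>z. w z i * w z j \<partial>ball_unif d)"
      by (rule integral_ball_unif_signed_involution[where g = "\<lambda>z. w z i * w z j"])
        (auto simp: s_def)
    moreover have "w (\<lambda>i\<in>{..<d}. s i * z (id i)) k = s k * w z k" if "k < d" for z k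
      using w_signed[OF that, of id s z] by (auto simp: s_def)
    ultimately have "(\<integral>z. - (w z i * w z j) \<partial>ball_unif d) = (\<integral>z. w z i * w z j \<partial>ball_unif d)"
      using assms False by (simp add: s_def)
    then show ?thesis
      using False by (simp add: w_def)
  next
    case True
    have swap: "(\<integral>z. w z k * w z k \<partial>ball_unif d) = (\<integral>z. w z i * w z i \<partial>ball_unif d)"
      if "k < d" for k
    proof -
      define \<sigma> where "\<sigma> m = (if m = i then k else if m = k then i else m)" for m
      have \<sigma>: "\<And>m. m < d \<Longrightarrow> \<sigma> m < d" "\<And>m. m < d \<Longrightarrow> \<sigma> (\<sigma> m) = m"
        using assms that by (auto simp: \<sigma>_def)
      have "(\<integral>z. w (\<lambda>i\<in>{..<d}. 1 * z (\<sigma> i)) i * w (\<lambda>i\<in>{..<d}. 1 * z (\<sigma> i)) i \<partial>ball_unif d)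
          = (\<integral>z. w z i * w z i \<partial>ball_unif d)"
        by (rule integral_ball_unif_signed_involution[where g = "\<lambda>z. w z i * w z i" and s = "\<lambda>_. 1"])
          (use \<sigma> in auto)
      moreover have "w (\<lambda>i\<in>{..<d}. 1 * z (\<sigma> i)) i = w z k" for z
        using w_signed[OF assms(1) \<sigma>, of "\<lambda>_. 1" z] by (simp add: \<sigma>_def)
      ultimately show ?thesis
        by simp
    qed
    have d: "d \<ge> 1"
      using assms by simp
    have "(\<integral>z. (\<Sum>k<d. w z k * w z k) \<partial>ball_unif d) = (\<integral>z. 1 \<partial>ball_unif d)"
    proof (rule integral_cong_AE)
      show "AE z in ball_unif d. (\<Sum>k<d. w z k * w z k) = 1"
        using AE_ball_unif_sgn[OF d]
      proof eventually_elim
        case (elim z)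
        then have "inner (sgn (fseq_of d z)) (sgn (fseq_of d z)) = 1"
          by (simp add: dot_square_norm)
        then show ?case
          using elim by (simp add: w_def inner_euc[of _ d])
      qed
    qed auto
    then have "(\<Sum>k<d. \<integral>z. w z k * w z k \<partial>ball_unif d) = 1"
      using int prob_space by simp
    moreover have "(\<Sum>k<d. \<integral>z. w z k * w z k \<partial>ball_unif d)
        = real d * (\<integral>z. w z i * w z i \<partial>ball_unif d)"
      by (subst sum.cong[OF refl swap]) auto
    ultimately show ?thesis
      using True d by (simp add: w_def[symmetric] eq_divide_eq mult.commute)
  qed
qed

lemma integral_inner_sq_ball_unif:
  assumes "a \<in> euc d"
  shows "(\<integral>z. (inner a (sgn (fseq_of d z)))\<^sup>2 \<partial>ball_unif d) = (norm a)\<^sup>2 / real d"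
proof -
  define w where "w z i = coord (sgn (fseq_of d z)) i" for z i
  have int: "integrable (ball_unif d) (\<lambda>z. w z i * w z j)" for i j
    unfolding w_def by (rule integrable_coord_sgn_mult)
  have "(\<integral>z. (inner a (sgn (fseq_of d z)))\<^sup>2 \<partial>ball_unif d)
      = (\<integral>z. (\<Sum>i<d. \<Sum>j<d. (coord a i * coord a j) * (w z i * w z j)) \<partial>ball_unif d)"
    by (simp add: inner_euc[OF assms] power2_eq_square sum_product w_def mult_ac)
  also have "\<dots> = (\<Sum>i<d. \<Sum>j<d. (coord a i * coord a j) * (\<integral>z. w z i * w z j \<partial>ball_unif d))"
    using int by simp
  also have "\<dots> = (\<Sum>i<d. \<Sum>j<d. if i = j then coord a i * coord a j / real d else 0)"
    by (intro sum.cong) (auto simp: w_def second_moments_ball_unif)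
  also have "\<dots> = inner a a / real d"
    by (simp add: inner_euc[OF assms] sum_divide_distrib)
  finally show ?thesis
    by (simp add: dot_square_norm)
qed

lemma sphere_euc_sets: "sphere 0 1 \<inter> euc d \<in> sets borel"
proof -
  have "sphere 0 1 = {x :: fseq. norm x = 1}"
    by auto
  then have "closed (sphere 0 1 :: fseq set)"
    by (simp add: closed_Collect_eq continuous_intros)
  then show ?thesis
    using closed_euc by (intro sets.Int borel_closed) auto
qed

lemma space_unif_sphere [simp]: "space (unif_sphere d) = sphere 0 1 \<inter> euc d"
  and sets_unif_sphere [measurable_cong]:
    "sets (unif_sphere d) = sets (restrict_space borel (sphere 0 1 \<inter> euc d))"
  using sphere_euc_sets[of d]
  by (auto simp: unif_sphere_def space_restrict_space intro!: sets_restrict_space_cong)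

lemma AE_distr_sgn:
  assumes "d \<ge> 1"
  shows "AE x in distr (ball_unif d) borel (\<lambda>z. sgn (fseq_of d z)). x \<in> sphere 0 1 \<inter> euc d"
  using AE_ball_unif_sgn[OF assms] sphere_euc_sets[of d]
  by (subst AE_distr_iff) (simp_all only: space_borel UNIV_I simp_thms Collect_mem_eq, auto)

lemma prob_space_unif_sphere:
  assumes "d \<ge> 1"
  shows "prob_space (unif_sphere d)"
proof -
  interpret B: prob_space "ball_unif d"
    by (rule prob_space_ball_unif)
  interpret D: prob_space "distr (ball_unif d) borel (\<lambda>z. sgn (fseq_of d z))"
    by (rule B.prob_space_distr) auto
  show ?thesis
    unfolding unif_sphere_def
    using AE_distr_sgn[OF assms] sphere_euc_sets[of d]
    by (intro prob_space_restrict_space) (auto simp: D.emeasure_eq_1_AE)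
qed

text \<open>
  Isotropy: a uniform direction sees, on average, the fraction \<open>1 / d\<close> of the squared length of any
  fixed vector. The factor \<open>d\<close> in the algorithm's update compensates for it.
\<close>
lemma integral_inner_sq_unif_sphere:
  assumes "d \<ge> 1" and a: "a \<in> euc d"
  shows "(\<integral>x. (inner a x)\<^sup>2 \<partial>unif_sphere d) = (norm a)\<^sup>2 / real d"
proof -
  let ?D = "distr (ball_unif d) borel (\<lambda>z. sgn (fseq_of d z))"
  let ?S = "sphere 0 1 \<inter> euc d"
  have "(\<integral>x. (inner a x)\<^sup>2 \<partial>unif_sphere d) = (\<integral>x. indicator ?S x *\<^sub>R (inner a x)\<^sup>2 \<partial>?D)"
    unfolding unif_sphere_def using sphere_euc_sets[of d] by (intro integral_restrict_space) auto
  also have "\<dots> = (\<integral>x. (inner a x)\<^sup>2 \<partial>?D)"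
    using AE_distr_sgn[OF assms(1)] sphere_euc_sets[of d]
    by (intro integral_cong_AE) (auto elim: eventually_mono)
  also have "\<dots> = (\<integral>z. (inner a (sgn (fseq_of d z)))\<^sup>2 \<partial>ball_unif d)"
    by (intro integral_distr) auto
  finally show ?thesis
    using integral_inner_sq_ball_unif[OF a] by simp
qed

section \<open>Gradients on the leader's space and descent along a noisy difference\<close>

lemma has_derivative_along_line:
  fixes h :: "'a::real_normed_vector \<Rightarrow> real"
  assumes "(h has_derivative D) (at (x + s *\<^sub>R u) within V)" "subspace V" "x \<in> V" "u \<in> V"
  shows "((\<lambda>r. h (x + r *\<^sub>R u)) has_real_derivative D u) (at s)"
proof -
  have "(\<lambda>r. x + r *\<^sub>R u) ` UNIV \<subseteq> V"
    using assms by (auto intro: subspace_add subspace_scale)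
  then have "(h has_derivative D) (at (x + s *\<^sub>R u) within (\<lambda>r. x + r *\<^sub>R u) ` UNIV)"
    using assms(1) has_derivative_subset by blast
  moreover have "((\<lambda>r. x + r *\<^sub>R u) has_derivative (\<lambda>r. r *\<^sub>R u)) (at s)"
    by (auto intro!: derivative_eq_intros)
  ultimately have "((\<lambda>r. h (x + r *\<^sub>R u)) has_derivative (\<lambda>r. D (r *\<^sub>R u))) (at s)"
    by (rule has_derivative_in_compose[rotated])
  moreover have "D (r *\<^sub>R u) = D u * r" for r
    using has_derivative_linear[OF assms(1)] by (simp add: linear_scale)
  ultimately show ?thesis
    by (simp add: has_field_derivative_def)
qed

text \<open>
  The constraint \<open>g \<in> euc d\<close> in \<^const>\<open>grad\<close> makes the gradient unique: two candidates agree on every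
  direction of \<open>euc d\<close>, hence on their own difference.
\<close>
lemma grad_eqI:
  assumes "x \<in> euc d" "g \<in> euc d" "(h has_derivative inner g) (at x within euc d)"
  shows "grad d h x = g"
  unfolding grad_def
proof (rule the_equality)
  fix g'
  assume g': "g' \<in> euc d \<and> (h has_derivative inner g') (at x within euc d)"
  define u where "u = g' - g"
  have u: "u \<in> euc d"
    using g' assms(2) unfolding u_def by (intro subspace_diff[OF subspace_euc]) auto
  have "((\<lambda>r. h (x + r *\<^sub>R u)) has_real_derivative inner g u) (at 0)"
    and "((\<lambda>r. h (x + r *\<^sub>R u)) has_real_derivative inner g' u) (at 0)"
    using g' assms u by (auto intro!: has_derivative_along_line[where V = "euc d"] subspace_euc)
  then have "inner g u = inner g' u"
    by (rule DERIV_unique)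
  then have "inner u u = 0"
    by (simp add: u_def inner_diff_left)
  then show "g' = g"
    by (simp add: u_def)
qed (use assms in simp)

text \<open>
  The Lipschitz field provided by \<^const>\<open>smooth_on\<close> may have components outside \<open>euc d\<close>. Its
  orthogonal projection to \<open>euc d\<close> represents the same derivative, so it is the gradient, and as a
  contraction the projection keeps the Lipschitz constant.
\<close>
lemma smooth_on_grad:
  assumes "smooth_on l (euc d) h"
  shows grad_in_euc: "x \<in> euc d \<Longrightarrow> grad d h x \<in> euc d"
    and has_derivative_grad:
      "x \<in> euc d \<Longrightarrow> (h has_derivative inner (grad d h x)) (at x within euc d)"
    and lipschitz_grad: "l-lipschitz_on (euc d) (grad d h)"
proof -
  obtain g where g: "\<And>z. z \<in> euc d \<Longrightarrow> (h has_derivative inner (g z)) (at z within euc d)"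
    and lip: "l-lipschitz_on (euc d) g"
    using assms by (auto simp: smooth_on_def)
  \<comment> \<open>The orthogonal projection to \<open>euc d\<close> truncates a sequence.\<close>
  define P where "P z = fseq_of d (coord z)" for z
  have inner_P: "inner (P z) u = inner z u" if "u \<in> euc d" for z u
    by (simp add: inner_commute[of _ u] inner_euc[OF that] P_def)
  have norm_P: "norm (P z) \<le> norm z" for z
  proof -
    have "norm (P z) * norm (P z) = inner z (P z)"
      by (subst inner_P[symmetric]) (simp_all add: P_def dot_square_norm power2_eq_square)
    also have "\<dots> \<le> norm z * norm (P z)"
      by (rule norm_cauchy_schwarz)
    finally show ?thesis
      by (cases "norm (P z) = 0") auto
  qed
  have P_diff: "P (z - z') = P z - P z'" for z z'
    by (intro fseq_eqI) (simp add: P_def)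
  have deriv: "(h has_derivative inner (P (g z))) (at z within euc d)" if z: "z \<in> euc d" for z
  proof -
    have "inner (P (g z)) (y - z) = inner (g z) (y - z)" if "y \<in> euc d" for y
      by (rule inner_P) (use z that in \<open>intro subspace_diff[OF subspace_euc]\<close>)
    then have "\<forall>\<^sub>F y in at z within euc d. inner (P (g z)) (y - z) = inner (g z) (y - z)"
      by (auto simp: eventually_at_filter)
    then have ev: "\<forall>\<^sub>F y in at z within euc d.
        (1 / norm (y - z)) *\<^sub>R (h y - (h z + inner (P (g z)) (y - z)))
      = (1 / norm (y - z)) *\<^sub>R (h y - (h z + inner (g z) (y - z)))"
      by eventually_elim simp
    then show ?thesis
      using g[OF z] unfolding has_derivative_within tendsto_cong[OF ev]
      by (simp add: bounded_linear_inner_right)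
  qed
  have grad: "grad d h z = P (g z)" if "z \<in> euc d" for z
    using that deriv by (intro grad_eqI) (auto simp: P_def)
  show "grad d h x \<in> euc d" if "x \<in> euc d"
    using grad[OF that] by (simp add: P_def)
  show "(h has_derivative inner (grad d h x)) (at x within euc d)" if "x \<in> euc d"
    using grad[OF that] deriv[OF that] by simp
  show "l-lipschitz_on (euc d) (grad d h)"
  proof (rule lipschitz_onI)
    fix x y
    assume xy: "x \<in> euc d" "y \<in> euc d"
    then have "dist (grad d h x) (grad d h y) \<le> dist (g x) (g y)"
      using norm_P[of "g x - g y"] by (simp add: grad dist_norm P_diff)
    also have "\<dots> \<le> l * dist x y"
      using lipschitz_onD[OF lip] xy by blast
    finally show "dist (grad d h x) (grad d h y) \<le> l * dist x y" .
  qed (use lip lipschitz_on_nonneg in blast)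
qed

text \<open>
  By the mean value theorem the remainder is the inner product of \<open>u\<close> with a difference of two
  gradients that are evaluated at most \<open>norm u\<close> apart. Integrating along the segment would halve the
  constant, which does not affect the order of the final bound.
\<close>
lemma taylor_remainder_le:
  assumes h: "smooth_on l (euc d) h" and x: "x \<in> euc d" and u: "u \<in> euc d"
  shows "\<bar>h (x + u) - h x - inner (grad d h x) u\<bar> \<le> l * (norm u)\<^sup>2"
proof -
  have line: "x + r *\<^sub>R u \<in> euc d" for r
    using x u by (intro subspace_add subspace_scale subspace_euc)
  have "((\<lambda>r. h (x + r *\<^sub>R u)) has_real_derivative inner (grad d h (x + r *\<^sub>R u)) u) (at r)" for r
    by (rule has_derivative_along_line[OF has_derivative_grad[OF h line] subspace_euc x u])
  then obtain r where r: "0 < r" "r < 1"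
    "h (x + 1 *\<^sub>R u) - h (x + 0 *\<^sub>R u) = (1 - 0) * inner (grad d h (x + r *\<^sub>R u)) u"
    using MVT2[of 0 1 "\<lambda>r. h (x + r *\<^sub>R u)" "\<lambda>r. inner (grad d h (x + r *\<^sub>R u)) u"] by auto
  then have "\<bar>h (x + u) - h x - inner (grad d h x) u\<bar>
      = \<bar>inner (grad d h (x + r *\<^sub>R u) - grad d h x) u\<bar>"
    by (simp add: inner_diff_left)
  also have "\<dots> \<le> norm (grad d h (x + r *\<^sub>R u) - grad d h x) * norm u"
    by (rule Cauchy_Schwarz_ineq2)
  also have "norm (grad d h (x + r *\<^sub>R u) - grad d h x) \<le> l * (r * norm u)"
    using lipschitz_onD[OF lipschitz_grad[OF h] line[of r] x] r by (simp add: dist_norm)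
  also have "\<dots> \<le> l * norm u"
    using r lipschitz_on_nonneg[OF lipschitz_grad[OF h]]
    by (intro mult_left_mono) (auto intro: mult_left_le_one_le)
  finally show ?thesis
    by (simp add: power2_eq_square mult_right_mono)
qed

text \<open>
  A small step along the gradient \<open>a\<close> increases \<open>h\<close> at a rate close to \<open>norm a\<close>, whereas \<open>L\<close>
  bounds this rate.
\<close>
lemma norm_grad_le:
  assumes h: "smooth_on l (euc d) h" and L: "L-lipschitz_on (euc d) h" and x: "x \<in> euc d"
  shows "norm (grad d h x) \<le> L"
proof (rule ccontr)
  define a where "a = grad d h x"
  assume "\<not> norm (grad d h x) \<le> L"
  then have gt: "norm a > L"
    by (simp add: a_def)
  have L0: "L \<ge> 0" and l0: "l \<ge> 0"
    using L lipschitz_grad[OF h] lipschitz_on_nonneg by blast+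
  \<comment> \<open>Small enough for the second-order error in the rate, \<open>l * (s * norm a)\<close>, to stay below
      the excess \<open>norm a - L\<close>.\<close>
  define s where "s = (norm a - L) / (l * norm a + 1)"
  have den: "l * norm a + 1 > 0"
    using l0 by (simp add: add_nonneg_pos)
  have s: "s > 0" "s * (l * norm a + 1) = norm a - L"
    using gt den by (auto simp: s_def)
  have a: "a \<in> euc d"
    using grad_in_euc[OF h x] by (simp add: a_def)
  have sa: "s *\<^sub>R a \<in> euc d"
    using a by (intro subspace_scale subspace_euc)
  have "s * (norm a)\<^sup>2 = inner a (s *\<^sub>R a)"
    by (simp add: dot_square_norm)
  also have "\<dots> \<le> h (x + s *\<^sub>R a) - h x + l * (norm (s *\<^sub>R a))\<^sup>2"
    using taylor_remainder_le[OF h x sa] by (simp add: a_def)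
  also have "h (x + s *\<^sub>R a) - h x \<le> L * norm (s *\<^sub>R a)"
    using lipschitz_onD[OF L subspace_add[OF subspace_euc x sa] x] by (simp add: dist_norm)
  finally have "(s * norm a) * norm a \<le> (s * norm a) * (L + l * (s * norm a))"
    using s by (simp add: power2_eq_square algebra_simps)
  moreover have "s * norm a > 0"
    using s(1) gt L0 by (intro mult_pos_pos) linarith+
  ultimately have "norm a \<le> L + l * (s * norm a)"
    by (simp only: mult_le_cancel_left_pos)
  then show False
    using s by (simp add: algebra_simps)
qed

text \<open>
  One update of the algorithm, for a fixed direction and an observed difference \<open>y\<close> with error at most
  \<open>\<epsilon>\<close>. Dividing \<open>y\<close> by \<open>\<delta>\<close> gives \<open>s + \<tau>\<close> with \<open>\<tau>\<close> of order \<open>l * \<delta> + \<epsilon> / \<delta>\<close>, so the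
  first-order change of \<open>h\<close> is \<open>- \<eta> * d * (s\<^sup>2 + \<tau> * s)\<close>, and half of \<open>s\<^sup>2\<close> pays for the cross term. The
  second-order change is bounded through the Lipschitz constant: \<open>y / \<delta>\<close> is at most \<open>L + \<epsilon> / \<delta>\<close>, so
  no second moment of the update is required.
\<close>
lemma zeroth_order_descent:
  assumes h: "smooth_on l (euc d) h" and L: "L-lipschitz_on (euc d) h"
    and x: "x \<in> euc d" and v: "v \<in> euc d" "norm v = 1"
    and pos: "\<delta> > 0" "\<eta> \<ge> 0"
    and err: "\<bar>y - (h (x + \<delta> *\<^sub>R v) - h x)\<bar> \<le> \<epsilon>"
  defines "s \<equiv> inner (grad d h x) v"
  shows "h (x - (\<eta> * (real d / \<delta> * y)) *\<^sub>R v)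
           \<le> h x - \<eta> * real d * s\<^sup>2 / 2 + \<eta> * real d * (l * \<delta> + \<epsilon> / \<delta>)\<^sup>2 / 2
              + l * (\<eta> * real d * (L + \<epsilon> / \<delta>))\<^sup>2"
proof -
  have l0: "l \<ge> 0"
    using lipschitz_grad[OF h] lipschitz_on_nonneg by blast
  have dv: "\<delta> *\<^sub>R v \<in> euc d"
    using v by (intro subspace_scale subspace_euc)
  define \<tau> where "\<tau> = y / \<delta> - s"
  define q where "q = \<eta> * (real d / \<delta> * y)"
  have qv: "- q *\<^sub>R v \<in> euc d"
    using v by (intro subspace_scale subspace_euc)
  have "\<bar>y - \<delta> * s\<bar> \<le> l * \<delta>\<^sup>2 + \<epsilon>"
    using taylor_remainder_le[OF h x dv] err v pos by (simp add: s_def)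
  then have "\<bar>y - \<delta> * s\<bar> / \<delta> \<le> (l * \<delta>\<^sup>2 + \<epsilon>) / \<delta>"
    using pos by (intro divide_right_mono) auto
  moreover have "\<bar>y - \<delta> * s\<bar> / \<delta> = \<bar>\<tau>\<bar>"
  proof -
    have "\<tau> = (y - \<delta> * s) / \<delta>"
      using pos by (simp add: \<tau>_def diff_divide_distrib)
    then show ?thesis
      using pos by (simp add: abs_divide)
  qed
  moreover have "(l * \<delta>\<^sup>2 + \<epsilon>) / \<delta> = l * \<delta> + \<epsilon> / \<delta>"
    using pos by (simp add: add_divide_distrib power2_eq_square)
  ultimately have tau: "\<bar>\<tau>\<bar> \<le> l * \<delta> + \<epsilon> / \<delta>"
    by simp
  then have tau2: "\<tau>\<^sup>2 \<le> (l * \<delta> + \<epsilon> / \<delta>)\<^sup>2"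
    by (metis abs_ge_zero power2_abs power_mono)
  have "\<bar>h (x + \<delta> *\<^sub>R v) - h x\<bar> \<le> L * \<delta>"
    using lipschitz_onD[OF L subspace_add[OF subspace_euc x dv] x] pos v by (simp add: dist_norm)
  then have "\<bar>y\<bar> \<le> L * \<delta> + \<epsilon>"
    using err by linarith
  then have "\<bar>y\<bar> / \<delta> \<le> (L * \<delta> + \<epsilon>) / \<delta>"
    using pos by (intro divide_right_mono) auto
  then have "\<bar>y\<bar> / \<delta> \<le> L + \<epsilon> / \<delta>"
    using pos by (simp add: add_divide_distrib)
  then have "\<eta> * real d * (\<bar>y\<bar> / \<delta>) \<le> \<eta> * real d * (L + \<epsilon> / \<delta>)"
    using pos by (intro mult_left_mono) auto
  moreover have "\<bar>q\<bar> = \<eta> * real d * (\<bar>y\<bar> / \<delta>)"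
    using pos by (simp add: q_def abs_mult)
  ultimately have "q\<^sup>2 \<le> (\<eta> * real d * (L + \<epsilon> / \<delta>))\<^sup>2"
    by (metis abs_ge_zero power2_abs power_mono)
  then have q2: "l * q\<^sup>2 \<le> l * (\<eta> * real d * (L + \<epsilon> / \<delta>))\<^sup>2"
    using l0 by (rule mult_left_mono)
  have "h (x - q *\<^sub>R v) \<le> h x - q * s + l * q\<^sup>2"
    using taylor_remainder_le[OF h x qv] v by (simp add: s_def)
  moreover have "q * s = \<eta> * real d * (s\<^sup>2 + \<tau> * s)"
    by (simp add: q_def \<tau>_def power2_eq_square algebra_simps)
  moreover have "\<eta> * real d * (s\<^sup>2 + \<tau> * s) \<ge> \<eta> * real d * (s\<^sup>2 / 2 - (l * \<delta> + \<epsilon> / \<delta>)\<^sup>2 / 2)"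
  proof (rule mult_left_mono)
    have "0 \<le> (s + \<tau>)\<^sup>2"
      by simp
    also have "\<dots> = s\<^sup>2 + 2 * (\<tau> * s) + \<tau>\<^sup>2"
      by (simp add: power2_sum)
    finally show "s\<^sup>2 / 2 - (l * \<delta> + \<epsilon> / \<delta>)\<^sup>2 / 2 \<le> s\<^sup>2 + \<tau> * s"
      using tau2 by linarith
  qed (use pos in simp)
  ultimately show ?thesis
    using q2 unfolding q_def[symmetric] by (simp add: algebra_simps)
qed

section \<open>The iterates as random variables\<close>

lemma C2_on_imp_continuous_on:
  assumes "C2_on V S h"
  shows "continuous_on S h"
proof -
  obtain U g D where U: "S \<subseteq> U \<inter> V" "\<And>z. z \<in> S \<Longrightarrow> g z = h z"
    and D: "\<And>z. z \<in> U \<inter> V \<Longrightarrow> (g has_derivative D z) (at z within V)"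
    using assms unfolding C2_on_def by blast
  have "continuous_on (U \<inter> V) g"
    unfolding continuous_on_eq_continuous_within
  proof
    fix z
    assume "z \<in> U \<inter> V"
    then have "continuous (at z within V) g"
      using D has_derivative_continuous by blast
    then show "continuous (at z within U \<inter> V) g"
      by (rule continuous_within_subset) auto
  qed
  then have "continuous_on S g"
    using U(1) continuous_on_subset by blast
  then show ?thesis
    using U(2) by (subst continuous_on_cong[OF refl, of S h g]) auto
qed

lemma follower_in:
  assumes "update_maps d Y H" "x \<in> euc d" "y \<in> Y"
  shows "follower H x y k \<in> Y"
  by (induction k) (use assms in \<open>auto simp: update_maps_def\<close>)

lemma measurable_pair_restrict_space:
  fixes X :: "_ \<Rightarrow> 'a::second_countable_topology" and Z :: "_ \<Rightarrow> 'b::second_countable_topology"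
  assumes "X \<in> measurable M (restrict_space borel A)" "Z \<in> measurable M (restrict_space borel B)"
  shows "(\<lambda>\<omega>. (X \<omega>, Z \<omega>)) \<in> measurable M (restrict_space borel (A \<times> B))"
  using assms by (auto simp: measurable_restrict_space2_iff intro!: borel_measurable_Pair)

lemma measurable_follower:
  fixes H :: "nat \<Rightarrow> real^'m \<Rightarrow> fseq \<Rightarrow> real^'m"
  assumes H: "update_maps d Y H"
    and X: "X \<in> measurable M (restrict_space borel (euc d))"
    and Z: "Z \<in> measurable M (restrict_space borel Y)"
  shows "(\<lambda>\<omega>. follower H (X \<omega>) (Z \<omega>) k) \<in> measurable M (restrict_space borel Y)"
proof (induction k)
  case (Suc k)
  have Hk: "(\<lambda>(y, x). H k y x) \<in> borel_measurable (restrict_space borel (Y \<times> euc d))"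
    using H by (simp add: update_maps_def)
  have "(\<lambda>\<omega>. H k (follower H (X \<omega>) (Z \<omega>) k) (X \<omega>)) \<in> borel_measurable M"
    using measurable_compose[OF measurable_pair_restrict_space[OF Suc X] Hk] by simp
  moreover have "H k (follower H (X \<omega>) (Z \<omega>) k) (X \<omega>) \<in> Y" if "\<omega> \<in> space M" for \<omega>
    using measurable_space[OF X that] measurable_space[OF Suc that] H
    by (auto simp: update_maps_def space_restrict_space)
  ultimately show ?case
    by (auto simp: measurable_restrict_space2_iff)
qed (use Z in simp)

text \<open>
  The state before round \<open>t\<close> depends on the earlier directions only, which is what makes it independent
  of the direction sampled in round \<open>t\<close>.
\<close>
lemma run_cong:
  "(\<And>s. s < t \<Longrightarrow> v s = v' s) \<Longrightarrow>
     run d K f H \<eta> \<delta> x0 y0 yt0 v t = run d K f H \<eta> \<delta> x0 y0 yt0 v' t"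
  by (induction t) auto

text \<open>
  The part of the setting that makes the iterates well-defined random variables. The step sizes and
  radii are arbitrary here.
\<close>
locale perturbed_game =
  fixes d K :: nat and Y :: "(real^'m) set" and f :: "fseq \<Rightarrow> real^'m \<Rightarrow> real"
    and H :: "nat \<Rightarrow> real^'m \<Rightarrow> fseq \<Rightarrow> real^'m" and \<eta> \<delta> :: "nat \<Rightarrow> real"
    and x0 :: fseq and y0 yt0 :: "real^'m"
  assumes d: "d \<ge> 1"
    and f: "continuous_on (euc d \<times> Y) (\<lambda>(x, y). f x y)"
    and H: "update_maps d Y H"
    and x0: "x0 \<in> euc d" and y0: "y0 \<in> Y" and yt0: "yt0 \<in> Y"
begin

abbreviation state :: "(nat \<Rightarrow> fseq) \<Rightarrow> nat \<Rightarrow> fseq \<times> (real^'m) \<times> (real^'m)" where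
  "state \<equiv> run d K f H \<eta> \<delta> x0 y0 yt0"

definition leader :: "(nat \<Rightarrow> fseq) \<Rightarrow> nat \<Rightarrow> fseq" where
  "leader v t = fst (state v t)"
definition init_pert :: "(nat \<Rightarrow> fseq) \<Rightarrow> nat \<Rightarrow> real^'m" where
  "init_pert v t = fst (snd (state v t))"
definition init_base :: "(nat \<Rightarrow> fseq) \<Rightarrow> nat \<Rightarrow> real^'m" where
  "init_base v t = snd (snd (state v t))"

definition payoff_diff :: "(nat \<Rightarrow> fseq) \<Rightarrow> nat \<Rightarrow> real" where
  "payoff_diff v t =
     (let x = leader v t; xh = x + \<delta> t *\<^sub>R v t
      in f xh (follower H xh (init_pert v t) K) - f x (follower H x (init_base v t) K))"

lemma leader_0: "leader v 0 = x0"
  and init_pert_0: "init_pert v 0 = y0"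
  and init_base_0: "init_base v 0 = yt0"
  by (simp_all add: leader_def init_pert_def init_base_def)

lemma leader_Suc:
    "leader v (Suc t) = leader v t - (\<eta> t * (real d / \<delta> t * payoff_diff v t)) *\<^sub>R v t"
  and init_pert_Suc: "init_pert v (Suc t) = follower H (leader v t) (init_base v t) K"
  and init_base_Suc: "init_base v (Suc t) = follower H (leader v t) (init_base v t) K"
  by (simp_all add: leader_def init_pert_def init_base_def payoff_diff_def Let_def case_prod_beta
      mult.assoc)

lemma state_in:
  assumes "\<And>s. s < t \<Longrightarrow> v s \<in> euc d"
  shows "leader v t \<in> euc d \<and> init_pert v t \<in> Y \<and> init_base v t \<in> Y"
  using assms
proof (induction t)
  case 0
  then show ?case
    by (simp add: leader_0 init_pert_0 init_base_0 x0 y0 yt0)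
next
  case (Suc t)
  then have "leader v t \<in> euc d" "init_base v t \<in> Y" "v t \<in> euc d"
    by auto
  then show ?case
    unfolding leader_Suc init_pert_Suc init_base_Suc
    by (auto intro!: follower_in[OF H] subspace_diff subspace_scale subspace_euc)
qed

lemmas leader_in = state_in[THEN conjunct1]

lemma measurable_state:
  assumes v: "\<And>s. s < t \<Longrightarrow> (\<lambda>\<omega>. \<omega> s) \<in> measurable M (restrict_space borel (euc d))"
  shows "(\<lambda>\<omega>. leader \<omega> t) \<in> measurable M (restrict_space borel (euc d)) \<and>
         (\<lambda>\<omega>. init_pert \<omega> t) \<in> measurable M (restrict_space borel Y) \<and>
         (\<lambda>\<omega>. init_base \<omega> t) \<in> measurable M (restrict_space borel Y)"
  using v
proof (induction t)
  case 0
  then show ?case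
    using x0 y0 yt0
    by (auto simp: leader_0 init_pert_0 init_base_0 intro!: measurable_const simp: space_restrict_space)
next
  case (Suc t)
  then have x: "(\<lambda>\<omega>. leader \<omega> t) \<in> measurable M (restrict_space borel (euc d))"
    and y: "(\<lambda>\<omega>. init_pert \<omega> t) \<in> measurable M (restrict_space borel Y)"
    and yt: "(\<lambda>\<omega>. init_base \<omega> t) \<in> measurable M (restrict_space borel Y)"
    and vt: "(\<lambda>\<omega>. \<omega> t) \<in> measurable M (restrict_space borel (euc d))"
    by auto
  have [measurable]: "(\<lambda>\<omega>. leader \<omega> t) \<in> borel_measurable M" "(\<lambda>\<omega>. \<omega> t) \<in> borel_measurable M"
    using x vt by (simp_all add: measurable_restrict_space2_iff)
  have payoff: "(\<lambda>\<omega>. f (X \<omega>) (Z \<omega>)) \<in> borel_measurable M"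
    if "X \<in> measurable M (restrict_space borel (euc d))" "Z \<in> measurable M (restrict_space borel Y)"
    for X Z
    using measurable_compose[OF measurable_pair_restrict_space[OF that]
        borel_measurable_continuous_on_restrict[OF f]] by simp
  have xh: "(\<lambda>\<omega>. leader \<omega> t + \<delta> t *\<^sub>R \<omega> t) \<in> measurable M (restrict_space borel (euc d))"
    using x vt
    by (auto simp: measurable_restrict_space2_iff Pi_iff
        intro!: subspace_add subspace_scale subspace_euc)
  have [measurable]: "(\<lambda>\<omega>. payoff_diff \<omega> t) \<in> borel_measurable M"
    unfolding payoff_diff_def Let_def
    by (intro borel_measurable_diff payoff x xh measurable_follower[OF H] y yt)
  have "(\<lambda>\<omega>. leader \<omega> (Suc t)) \<in> measurable M (restrict_space borel (euc d))"
    using x vt unfolding leader_Suc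
    by (auto simp: measurable_restrict_space2_iff Pi_iff
        intro!: subspace_diff subspace_scale subspace_euc)
  moreover have "(\<lambda>\<omega>. follower H (leader \<omega> t) (init_base \<omega> t) K)
      \<in> measurable M (restrict_space borel Y)"
    by (rule measurable_follower[OF H x yt])
  ultimately show ?case
    by (simp add: init_pert_Suc init_base_Suc)
qed

lemma measurable_directions:
  assumes "s < T"
  shows "(\<lambda>\<omega>. \<omega> s) \<in> measurable (directions d T) (restrict_space borel (euc d))"
proof -
  have "(\<lambda>\<omega>. \<omega> s) \<in> measurable (directions d T) (unif_sphere d)"
    unfolding directions_def using assms by (intro measurable_component_singleton) simp
  moreover have "(\<lambda>x. x) \<in> measurable (unif_sphere d) (restrict_space borel (euc d))"
    by (auto simp: measurable_restrict_space2_iff measurable_cong_sets[OF sets_unif_sphere refl]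
        space_restrict_space intro!: measurable_restrict_space1)
  ultimately show ?thesis
    using measurable_compose by blast
qed

text \<open>
  For a vector field \<open>a\<close> on the leader's space, Fubini integrates the direction of round \<open>t\<close> first. With
  the other directions held fixed, the leader's point is a constant, and isotropy applies.
\<close>
lemma expected_grad_sq:
  fixes a :: "fseq \<Rightarrow> fseq"
  assumes a: "continuous_on (euc d) a" "\<And>x. x \<in> euc d \<Longrightarrow> a x \<in> euc d"
    "\<And>x. x \<in> euc d \<Longrightarrow> norm (a x) \<le> L"
    and t: "t < T"
  shows "integrable (directions d T) (\<lambda>v. (inner (a (leader v t)) (v t))\<^sup>2)"
    and "(\<integral>v. (norm (a (leader v t)))\<^sup>2 \<partial>directions d T)
           = real d * (\<integral>v. (inner (a (leader v t)) (v t))\<^sup>2 \<partial>directions d T)"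
proof -
  interpret U: prob_space "unif_sphere d"
    using prob_space_unif_sphere[OF d] .
  interpret product_prob_space "\<lambda>_::nat. unif_sphere d"
    by standard
  interpret D: prob_space "directions d T"
    unfolding directions_def by (intro prob_space_PiM U.prob_space_axioms)
  have v_in: "v s \<in> sphere 0 1 \<inter> euc d" if "v \<in> space (directions d T)" "s < T" for v s
    using that by (auto simp: directions_def space_PiM PiE_iff)
  have x_in: "leader v t \<in> euc d" if "v \<in> space (directions d T)" for v
    using v_in[OF that] t by (intro leader_in) auto
  have [measurable]: "(\<lambda>v. v t) \<in> borel_measurable (directions d T)"
    using measurable_directions[OF t] by (simp add: measurable_restrict_space2_iff)
  have "(\<lambda>v. leader v t) \<in> measurable (directions d T) (restrict_space borel (euc d))"
    using measurable_state[of t "directions d T"] measurable_directions t by simp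
  from measurable_compose[OF this borel_measurable_continuous_on_restrict[OF a(1)]]
  have [measurable]: "(\<lambda>v. a (leader v t)) \<in> borel_measurable (directions d T)" .
  have bound: "(norm (a (leader v t)))\<^sup>2 \<le> L\<^sup>2" "(inner (a (leader v t)) (v t))\<^sup>2 \<le> L\<^sup>2"
    if v: "v \<in> space (directions d T)" for v
  proof -
    have n: "norm (a (leader v t)) \<le> L"
      using a(3) x_in[OF v] by blast
    then show "(norm (a (leader v t)))\<^sup>2 \<le> L\<^sup>2"
      by (intro power_mono) auto
    have "\<bar>inner (a (leader v t)) (v t)\<bar> \<le> norm (a (leader v t)) * norm (v t)"
      by (rule Cauchy_Schwarz_ineq2)
    also have "\<dots> \<le> L"
      using n v_in[OF v t] by simp
    finally show "(inner (a (leader v t)) (v t))\<^sup>2 \<le> L\<^sup>2"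
      by (metis abs_ge_zero power2_abs power_mono)
  qed
  show int: "integrable (directions d T) (\<lambda>v. (inner (a (leader v t)) (v t))\<^sup>2)"
    using bound(2) by (intro D.integrable_const_bound[where B = "L\<^sup>2"] AE_I2) auto
  have int': "integrable (directions d T) (\<lambda>v. (norm (a (leader v t)))\<^sup>2)"
    using bound(1) by (intro D.integrable_const_bound[where B = "L\<^sup>2"] AE_I2) auto
  let ?P = "\<Pi>\<^sub>M s\<in>{..<T} - {t}. unif_sphere d"
  have ins: "directions d T = (\<Pi>\<^sub>M s\<in>insert t ({..<T} - {t}). unif_sphere d)"
    using t by (simp add: directions_def insert_absorb)
  \<comment> \<open>Changing the direction of round \<open>t\<close> does not move the point at which it is sampled.\<close>
  have leader_upd: "leader (w(t := u)) t = leader w t" for w u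
    unfolding leader_def by (subst run_cong[of t _ w]) auto
  have in_P: "leader w t \<in> euc d" if "w \<in> space ?P" for w
    using that t by (intro leader_in) (auto simp: space_PiM PiE_iff)
  have "(\<integral>v. (inner (a (leader v t)) (v t))\<^sup>2 \<partial>directions d T)
      = (\<integral>w. (\<integral>u. (inner (a (leader w t)) u)\<^sup>2 \<partial>unif_sphere d) \<partial>?P)"
    using int unfolding ins by (subst product_integral_insert) (auto simp: leader_upd)
  also have "\<dots> = (\<integral>w. (norm (a (leader w t)))\<^sup>2 / real d \<partial>?P)"
    by (intro Bochner_Integration.integral_cong refl integral_inner_sq_unif_sphere d a(2) in_P)
  also have "\<dots> = (\<integral>w. (\<integral>u. (norm (a (leader w t)))\<^sup>2 \<partial>unif_sphere d) \<partial>?P) / real d"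
    using U.prob_space by simp
  also have "(\<integral>w. (\<integral>u. (norm (a (leader w t)))\<^sup>2 \<partial>unif_sphere d) \<partial>?P)
      = (\<integral>v. (norm (a (leader v t)))\<^sup>2 \<partial>directions d T)"
    using int' unfolding ins by (subst product_integral_insert) (auto simp: leader_upd)
  finally show "(\<integral>v. (norm (a (leader v t)))\<^sup>2 \<partial>directions d T)
           = real d * (\<integral>v. (inner (a (leader v t)) (v t))\<^sup>2 \<partial>directions d T)"
    using d by simp
qed

text \<open>
  The descent inequality holds for every sequence of directions, so the values of \<open>F\<close> telescope along
  each path, and a single expectation at the end replaces squared directional derivatives by squared
  gradients.
\<close>
lemma sum_expected_grad_sq_le:
  assumes F: "smooth_on l (euc d) F" and L: "L-lipschitz_on (euc d) F"
    and pos: "\<And>t. \<delta> t > 0" "\<And>t. \<eta> t \<ge> 0"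
    and err: "\<And>v t. (\<And>s. s \<le> t \<Longrightarrow> v s \<in> sphere 0 1 \<inter> euc d) \<Longrightarrow>
      \<bar>payoff_diff v t - (F (leader v t + \<delta> t *\<^sub>R v t) - F (leader v t))\<bar> \<le> \<epsilon>"
    and gap: "\<And>x. x \<in> euc d \<Longrightarrow> F x0 - F x \<le> \<Delta>"
  shows "(\<Sum>t<T. \<eta> t * (\<integral>v. (norm (grad d F (leader v t)))\<^sup>2 \<partial>directions d T)) / 2
    \<le> \<Delta> + (\<Sum>t<T. \<eta> t * real d * (l * \<delta> t + \<epsilon> / \<delta> t)\<^sup>2 / 2
                + l * (\<eta> t * real d * (L + \<epsilon> / \<delta> t))\<^sup>2)"
proof -
  define s where "s v t = inner (grad d F (leader v t)) (v t)" for v t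
  define b where "b t = \<eta> t * real d * (l * \<delta> t + \<epsilon> / \<delta> t)\<^sup>2 / 2
                + l * (\<eta> t * real d * (L + \<epsilon> / \<delta> t))\<^sup>2" for t
  interpret U: prob_space "unif_sphere d"
    using prob_space_unif_sphere[OF d] .
  interpret product_prob_space "\<lambda>_::nat. unif_sphere d"
    by standard
  interpret D: prob_space "directions d T"
    unfolding directions_def by (intro prob_space_PiM U.prob_space_axioms)
  note E = expected_grad_sq[OF lipschitz_on_continuous_on[OF lipschitz_grad[OF F]]
      grad_in_euc[OF F] norm_grad_le[OF F L]]
  have path: "(\<Sum>t<T. \<eta> t * real d * (s v t)\<^sup>2 / 2) \<le> \<Delta> + (\<Sum>t<T. b t)"
    if v: "v \<in> space (directions d T)" for v
  proof -
    have v_in: "v t \<in> sphere 0 1 \<inter> euc d" if "t < T" for t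
      using v that by (auto simp: directions_def space_PiM PiE_iff)
    have "F (leader v n) \<le> F x0 - (\<Sum>t<n. \<eta> t * real d * (s v t)\<^sup>2 / 2) + (\<Sum>t<n. b t)"
      if "n \<le> T" for n
      using that
    proof (induction n)
      case 0
      then show ?case
        by (simp add: leader_0)
    next
      case (Suc n)
      have x: "leader v n \<in> euc d"
        using v_in Suc.prems by (intro leader_in) auto
      have "F (leader v (Suc n)) \<le> F (leader v n) - \<eta> n * real d * (s v n)\<^sup>2 / 2 + b n"
        unfolding leader_Suc s_def b_def add.assoc[symmetric]
        by (rule zeroth_order_descent[OF F L x _ _ pos])
          (use v_in[of n] Suc.prems in \<open>auto intro!: err v_in\<close>)
      then show ?case
        using Suc by simp
    qed
    from this[of T] gap[of "leader v T"] leader_in[of T v] v_in show ?thesis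
      by auto
  qed
  have "(\<Sum>t<T. \<eta> t * (\<integral>v. (norm (grad d F (leader v t)))\<^sup>2 \<partial>directions d T)) / 2
      = (\<Sum>t<T. \<integral>v. \<eta> t * real d * (s v t)\<^sup>2 / 2 \<partial>directions d T)"
    unfolding s_def sum_divide_distrib by (intro sum.cong refl) (simp add: E(2))
  also have "\<dots> = (\<integral>v. (\<Sum>t<T. \<eta> t * real d * (s v t)\<^sup>2 / 2) \<partial>directions d T)"
    unfolding s_def by (rule Bochner_Integration.integral_sum[symmetric]) (simp add: E(1))
  also have "\<dots> \<le> (\<integral>v. \<Delta> + (\<Sum>t<T. b t) \<partial>directions d T)"
    using path unfolding s_def
    by (intro integral_mono) (auto intro!: Bochner_Integration.integrable_sum simp: E(1))
  also have "\<dots> = \<Delta> + (\<Sum>t<T. b t)"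
    using D.prob_space by simp
  finally show ?thesis
    by (simp add: b_def)
qed

end

section \<open>Solver accuracy and step sizes\<close>

text \<open>
  The bound is uniform in the initial point \<open>y\<close>: the diameter \<open>D\<close> of \<open>Y\<close> replaces the distance between
  \<open>y\<close> and the response, so the errors of earlier rounds need not be tracked through the warm starts.
\<close>
lemma follower_value_error:
  assumes A1: "A1 d Y f G Lx Ly ly LS Lh lh" and A3: "A3_1b d Y G H C \<rho>"
    and H: "update_maps d Y H" and C: "C \<ge> 0" "\<rho> \<ge> 0"
    and D: "\<And>y y'. y \<in> Y \<Longrightarrow> y' \<in> Y \<Longrightarrow> dist y y' \<le> D"
    and x: "x \<in> euc d" and y: "y \<in> Y"
  shows "\<bar>f x (follower H x y K) - hyper Y f G x\<bar> \<le> Ly * (C * \<rho> ^ K * D)"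
proof -
  have lip: "Ly-lipschitz_on Y (f x)" and single: "is_singleton (VI_set Y G x)"
    using A1 x unfolding A1_def by blast+
  from single have "sol Y G x \<in> VI_set Y G x"
    by (metis is_singleton_the_elem insertI1 sol_def)
  then have S: "sol Y G x \<in> Y"
    by (simp add: VI_set_def)
  have "dist (follower H x y K) (sol Y G x) \<le> C * \<rho> ^ K * dist y (sol Y G x)"
    using A3 x y unfolding A3_1b_def dist_norm by blast
  also have "\<dots> \<le> C * \<rho> ^ K * D"
    using D[OF y S] C by (intro mult_left_mono) auto
  finally have "Ly * dist (follower H x y K) (sol Y G x) \<le> Ly * (C * \<rho> ^ K * D)"
    using lipschitz_on_nonneg[OF lip] by (rule mult_left_mono)
  moreover have "\<bar>f x (follower H x y K) - hyper Y f G x\<bar> \<le> Ly * dist (follower H x y K) (sol Y G x)"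
    using lipschitz_onD[OF lip follower_in[OF H x y] S] unfolding hyper_def dist_real_def .
  ultimately show ?thesis
    by linarith
qed

lemma sum_inverse_le_ln:
  assumes "T \<ge> 1"
  shows "(\<Sum>t<T. 1 / real (t + 1)) \<le> 1 + ln (real T)"
  using assms
proof (induction T rule: nat_induct_at_least)
  case (Suc T)
  have "ln (real T / real (Suc T)) \<le> real T / real (Suc T) - 1"
    using Suc by (intro ln_le_minus_one) auto
  also have "\<dots> = - (1 / real (Suc T))"
    by (simp add: field_simps)
  finally have "1 / real (Suc T) \<le> ln (real (Suc T)) - ln (real T)"
    using Suc by (simp add: ln_div)
  with Suc show ?case
    by simp
qed simp

text \<open>
  This is how the number of solver steps is chosen. For \<open>\<rho> = 0\<close> the logarithm and the quotient take
  their default value \<open>0\<close>, and one step suffices.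
\<close>
lemma contraction_power_le:
  assumes \<rho>: "0 \<le> \<rho>" "\<rho> < 1" and n: "T \<ge> 1" "d \<ge> 1" "K \<ge> 1"
    and K: "real K \<ge> 1 / \<bar>ln \<rho>\<bar> * (1/2 * ln (real T) + 2 * ln (real d))"
  shows "\<rho> ^ K \<le> 1 / (sqrt (real T) * (real d)\<^sup>2)"
proof (cases "\<rho> = 0")
  case False
  then have neg: "ln \<rho> < 0" and pos: "\<rho> > 0"
    using \<rho> by simp_all
  have "(1/2 * ln (real T) + 2 * ln (real d)) / (- ln \<rho>) \<le> real K"
    using K neg by simp
  then have "1/2 * ln (real T) + 2 * ln (real d) \<le> real K * (- ln \<rho>)"
    using neg by (subst (asm) pos_divide_le_eq) auto
  also have "1/2 * ln (real T) + 2 * ln (real d) = ln (sqrt (real T)) + ln ((real d)\<^sup>2)"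
    using n by (simp add: ln_sqrt ln_realpow)
  also have "\<dots> = ln (sqrt (real T) * (real d)\<^sup>2)"
    using n by (intro ln_mult_pos[symmetric]) auto
  finally have "real K * ln \<rho> \<le> - ln (sqrt (real T) * (real d)\<^sup>2)"
    by simp
  then have "exp (real K * ln \<rho>) \<le> exp (- ln (sqrt (real T) * (real d)\<^sup>2))"
    by simp
  moreover have "exp (real K * ln \<rho>) = \<rho> ^ K"
    using pos by (simp add: exp_of_nat_mult)
  moreover have "exp (- ln (sqrt (real T) * (real d)\<^sup>2)) = 1 / (sqrt (real T) * (real d)\<^sup>2)"
    using n by (simp add: exp_minus inverse_eq_divide)
  ultimately show ?thesis
    by simp
qed (use n in \<open>simp add: power_0_left\<close>)

text \<open>
  All three quantities of a round are tied to one rate \<open>\<kappa>\<close>: the radius is of order \<open>\<kappa>\<close>, the step size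
  and the solver error are of order \<open>\<kappa>\<^sup>2\<close>. Then the relative error \<open>l * \<delta> + \<epsilon> / \<delta>\<close> is of order
  \<open>\<kappa>\<close>, and both remainders of the descent inequality are of order \<open>(d * \<kappa>\<^sup>2)\<^sup>2\<close>.
\<close>
lemma descent_remainder_le:
  fixes l L E \<epsilon> \<kappa> \<eta> \<delta> :: real and d :: nat
  assumes "l \<ge> 0" "L \<ge> 0" and d: "d \<ge> 1" and pos: "\<eta> > 0" "\<delta> > 0"
    and \<kappa>: "\<kappa> > 0" "\<kappa> \<le> 1" and \<epsilon>: "\<epsilon> \<ge> 0" "\<epsilon> \<le> E * \<kappa>\<^sup>2"
  shows "(\<eta> * \<kappa>\<^sup>2) * real d * (l * (\<delta> * \<kappa>) + \<epsilon> / (\<delta> * \<kappa>))\<^sup>2 / 2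
      + l * ((\<eta> * \<kappa>\<^sup>2) * real d * (L + \<epsilon> / (\<delta> * \<kappa>)))\<^sup>2
    \<le> (\<eta> * (l * \<delta> + E / \<delta>)\<^sup>2 / 2 + l * (\<eta> * (L + E / \<delta>))\<^sup>2) * (real d * \<kappa>\<^sup>2)\<^sup>2"
proof -
  have "0 \<le> E * \<kappa>\<^sup>2"
    using \<epsilon> by linarith
  then have E: "E \<ge> 0"
    using \<kappa> by (simp add: zero_le_mult_iff)
  have "\<epsilon> / (\<delta> * \<kappa>) \<le> E * \<kappa>\<^sup>2 / (\<delta> * \<kappa>)"
    using \<epsilon> pos \<kappa> by (intro divide_right_mono) auto
  also have "\<dots> = E / \<delta> * \<kappa>"
    using \<kappa> by (simp add: power2_eq_square)
  finally have q: "\<epsilon> / (\<delta> * \<kappa>) \<le> E / \<delta> * \<kappa>" .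
  have q0: "\<epsilon> / (\<delta> * \<kappa>) \<ge> 0"
    using \<epsilon> pos \<kappa> by simp
  have "l * (\<delta> * \<kappa>) + \<epsilon> / (\<delta> * \<kappa>) \<le> (l * \<delta> + E / \<delta>) * \<kappa>"
    using q by (simp add: algebra_simps)
  then have "(l * (\<delta> * \<kappa>) + \<epsilon> / (\<delta> * \<kappa>))\<^sup>2 \<le> ((l * \<delta> + E / \<delta>) * \<kappa>)\<^sup>2"
    using q0 assms by (intro power_mono) auto
  then have "(\<eta> * \<kappa>\<^sup>2) * real d * (l * (\<delta> * \<kappa>) + \<epsilon> / (\<delta> * \<kappa>))\<^sup>2
      \<le> (\<eta> * \<kappa>\<^sup>2) * real d * ((l * \<delta> + E / \<delta>) * \<kappa>)\<^sup>2"
    using pos by (intro mult_left_mono) auto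
  also have "\<dots> = \<eta> * (l * \<delta> + E / \<delta>)\<^sup>2 * (real d * (\<kappa>\<^sup>2)\<^sup>2)"
    by (simp add: power_mult_distrib power2_eq_square mult_ac)
  also have "\<dots> \<le> \<eta> * (l * \<delta> + E / \<delta>)\<^sup>2 * (real d * \<kappa>\<^sup>2)\<^sup>2"
    unfolding power_mult_distrib[of "real d"] using d pos
    by (intro mult_left_mono mult_right_mono) (auto simp: power2_eq_square)
  finally have first: "(\<eta> * \<kappa>\<^sup>2) * real d * (l * (\<delta> * \<kappa>) + \<epsilon> / (\<delta> * \<kappa>))\<^sup>2
      \<le> \<eta> * (l * \<delta> + E / \<delta>)\<^sup>2 * (real d * \<kappa>\<^sup>2)\<^sup>2" .
  have "E / \<delta> * \<kappa> \<le> E / \<delta> * 1"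
    using E pos \<kappa> by (intro mult_left_mono) auto
  then have "L + \<epsilon> / (\<delta> * \<kappa>) \<le> L + E / \<delta>"
    using q by linarith
  then have "(\<eta> * \<kappa>\<^sup>2) * real d * (L + \<epsilon> / (\<delta> * \<kappa>)) \<le> (\<eta> * \<kappa>\<^sup>2) * real d * (L + E / \<delta>)"
    using pos by (intro mult_left_mono) auto
  then have "((\<eta> * \<kappa>\<^sup>2) * real d * (L + \<epsilon> / (\<delta> * \<kappa>)))\<^sup>2 \<le> ((\<eta> * \<kappa>\<^sup>2) * real d * (L + E / \<delta>))\<^sup>2"
    using pos q0 \<open>L \<ge> 0\<close> by (intro power_mono) auto
  also have "\<dots> = (\<eta> * (L + E / \<delta>))\<^sup>2 * (real d * \<kappa>\<^sup>2)\<^sup>2"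
    by (simp add: power_mult_distrib mult_ac)
  finally have "l * ((\<eta> * \<kappa>\<^sup>2) * real d * (L + \<epsilon> / (\<delta> * \<kappa>)))\<^sup>2
      \<le> l * ((\<eta> * (L + E / \<delta>))\<^sup>2 * (real d * \<kappa>\<^sup>2)\<^sup>2)"
    using \<open>l \<ge> 0\<close> by (rule mult_left_mono)
  with first show ?thesis
    unfolding distrib_right by (simp add: mult.assoc)
qed

theorem corollary2:
  fixes Y :: "(real^'m) set"
    and Lx Ly ly LS Lh lh C\<^sub>2 C\<^sub>3 \<rho> \<Delta> \<eta>b \<delta>b :: real
  assumes "convex Y" and "compact Y"
    and "C\<^sub>2 > 0" and "C\<^sub>3 > 0" and "0 \<le> \<rho>" and "\<rho> < 1" and "\<eta>b > 0" and "\<delta>b > 0"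
  shows "\<exists>(c::real) (p::nat).
    \<forall>(d::nat) (T::nat) (K::nat) (f :: fseq \<Rightarrow> real^'m \<Rightarrow> real) (G :: fseq \<Rightarrow> real^'m \<Rightarrow> real^'m)
      (H :: nat \<Rightarrow> real^'m \<Rightarrow> fseq \<Rightarrow> real^'m) x0 y0 yt0.
      d \<ge> 1 \<longrightarrow> T \<ge> 1 \<longrightarrow> K \<ge> 1 \<longrightarrow>
      x0 \<in> euc d \<longrightarrow> y0 \<in> Y \<longrightarrow> yt0 \<in> Y \<longrightarrow>
      smooth_game d Y f G \<longrightarrow> update_maps d Y H \<longrightarrow>
      A1 d Y f G Lx Ly ly LS Lh lh \<longrightarrow>
      A2 d Y H K C\<^sub>2 \<longrightarrow>
      A3_1b d Y G H C\<^sub>3 \<rho> \<longrightarrow>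
      (\<forall>x\<in>euc d. hyper Y f G x0 - hyper Y f G x \<le> \<Delta>) \<longrightarrow>
      2 * lh * \<eta>b \<le> real d \<longrightarrow>
      real K \<ge> 1 / \<bar>ln \<rho>\<bar> * (1/2 * ln (real T) + 2 * ln (real d)) \<longrightarrow>
      (let \<eta> = (\<lambda>t. \<eta>b * real (t + 1) powr (-1/2) * real d powr (-1));
           \<delta> = (\<lambda>t. \<delta>b * real (t + 1) powr (-1/4) * real d powr (-1/2))
       in Min ((\<lambda>t. \<integral>v. (norm (grad d (hyper Y f G) (iterate d K f H \<eta> \<delta> x0 y0 yt0 v t)))\<^sup>2
                  \<partial>directions d T) ` {0..T})
            \<le> c * (1 + ln (real T)) ^ p * (real d / sqrt (real T)))"
proof -
  obtain D where D: "\<And>y y'. y \<in> Y \<Longrightarrow> y' \<in> Y \<Longrightarrow> dist y y' \<le> D"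
    using compact_imp_bounded[OF \<open>compact Y\<close>] by (auto simp: bounded_two_points)
  \<comment> \<open>\<open>E0\<close> bounds the error of an observed payoff difference per unit of \<open>\<rho> ^ K\<close>, and
      \<open>c1 / (t + 1)\<close> bounds the error in the descent of round \<open>t\<close>.\<close>
  define E0 where "E0 = 2 * Ly * C\<^sub>3 * D"
  define c1 where "c1 = \<eta>b * (lh * \<delta>b + E0 / \<delta>b)\<^sup>2 / 2 + lh * (\<eta>b * (Lh + E0 / \<delta>b))\<^sup>2"
  show ?thesis
  proof (intro exI[of _ "2 * (\<Delta> + c1) / \<eta>b"] exI[of _ "1::nat"] allI impI, goal_cases)
    case (1 d T K f G H x0 y0 yt0)
    note d = 1(1) and T = 1(2) and K = 1(3) and init = 1(4-6) and game = 1(7) and maps = 1(8)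
      and A1 = 1(9) and A3 = 1(11) and gap = 1(12)[rule_format] and steps = 1(14)
    define F where "F = hyper Y f G"
    define \<eta> where "\<eta> = (\<lambda>t. \<eta>b * real (t + 1) powr (-1/2) * real d powr (-1))"
    define \<delta> where "\<delta> = (\<lambda>t. \<delta>b * real (t + 1) powr (-1/4) * real d powr (-1/2))"
    \<comment> \<open>The common rate in both schedules; \<open>(d * (\<kappa> t)\<^sup>2)\<^sup>2\<close> is \<open>1 / (t + 1)\<close>.\<close>
    define \<kappa> where "\<kappa> t = real (t + 1) powr (-1/4) * real d powr (-1/2)" for t
    interpret perturbed_game d K Y f H \<eta> \<delta> x0 y0 yt0
      using d init game maps C2_on_imp_continuous_on by unfold_locales (auto simp: smooth_game_def)
    have F: "smooth_on lh (euc d) F" and L: "Lh-lipschitz_on (euc d) F"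
      and Ly: "Ly-lipschitz_on Y (f x0)"
      using A1 x0 by (simp_all add: A1_def F_def)
    have lh0: "lh \<ge> 0"
      using lipschitz_grad[OF F] lipschitz_on_nonneg by blast
    have Lh0: "Lh \<ge> 0" and Ly0: "Ly \<ge> 0"
      using L Ly lipschitz_on_nonneg by blast+
    have D0: "D \<ge> 0"
      using D[OF y0 y0] by simp
    have E0: "E0 \<ge> 0"
      using Ly0 D0 \<open>C\<^sub>3 > 0\<close> by (simp add: E0_def)
    have \<Delta>0: "\<Delta> \<ge> 0"
      using gap[OF x0] by simp
    have c1: "c1 \<ge> 0"
      using \<open>\<eta>b > 0\<close> lh0 by (simp add: c1_def)
    have \<kappa>_pos: "\<kappa> t > 0" for t
      using d by (simp add: \<kappa>_def)
    have \<kappa>2: "(\<kappa> t)\<^sup>2 = 1 / (sqrt (real (t + 1)) * real d)" for t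
    proof -
      have "(\<kappa> t)\<^sup>2 = real (t + 1) powr (-1/2) * real d powr (-1)"
        using d by (simp add: \<kappa>_def power_mult_distrib powr_power)
      then show ?thesis
        using d by (simp add: powr_minus_divide powr_half_sqrt)
    qed
    have \<kappa>_le: "\<kappa> t \<le> 1" for t
    proof (rule power2_le_imp_le)
      have "1 * 1 \<le> sqrt (real (t + 1)) * real d"
        using d by (intro mult_mono) auto
      then show "(\<kappa> t)\<^sup>2 \<le> 1\<^sup>2"
        unfolding \<kappa>2 by simp
    qed simp
    have \<eta>_eq: "\<eta> t = \<eta>b * (\<kappa> t)\<^sup>2" for t
      using d by (simp add: \<eta>_def \<kappa>_def power_mult_distrib powr_power)
    have \<delta>_eq: "\<delta> t = \<delta>b * \<kappa> t" for t
      by (simp add: \<delta>_def \<kappa>_def)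
    have \<delta>_pos: "\<delta> t > 0" and \<eta>_pos: "\<eta> t \<ge> 0" for t
      using \<kappa>_pos \<open>\<eta>b > 0\<close> \<open>\<delta>b > 0\<close> by (simp_all add: \<delta>_eq \<eta>_eq)
    define \<epsilon> where "\<epsilon> = 2 * (Ly * (C\<^sub>3 * \<rho> ^ K * D))"
    have \<epsilon>0: "\<epsilon> \<ge> 0"
      using Ly0 D0 \<open>C\<^sub>3 > 0\<close> \<open>0 \<le> \<rho>\<close> by (simp add: \<epsilon>_def)
    have value_err: "\<bar>f x (follower H x y K) - F x\<bar> \<le> \<epsilon> / 2" if "x \<in> euc d" "y \<in> Y" for x y
      using follower_value_error[OF A1 A3 maps _ \<open>0 \<le> \<rho>\<close> D that, of K] \<open>C\<^sub>3 > 0\<close>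
      by (simp add: F_def \<epsilon>_def)
    have err: "\<bar>payoff_diff v t - (F (leader v t + \<delta> t *\<^sub>R v t) - F (leader v t))\<bar> \<le> \<epsilon>"
      if v: "\<And>s. s \<le> t \<Longrightarrow> v s \<in> sphere 0 1 \<inter> euc d" for v t
    proof -
      have st: "leader v t \<in> euc d" "init_pert v t \<in> Y" "init_base v t \<in> Y"
        using state_in[of t v] v by auto
      have "leader v t + \<delta> t *\<^sub>R v t \<in> euc d"
        using st v[of t] by (intro subspace_add subspace_scale subspace_euc) auto
      from value_err[OF this st(2)] value_err[OF st(1) st(3)] show ?thesis
        unfolding payoff_diff_def Let_def by linarith
    qed
    \<comment> \<open>Here \<open>sqrt T\<close> dominates \<open>sqrt (t + 1)\<close>, so the number of solver steps need not grow with \<open>t\<close>.\<close>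
    have \<epsilon>_le: "\<epsilon> \<le> E0 * (\<kappa> t)\<^sup>2" if "t < T" for t
    proof -
      have "\<rho> ^ K \<le> 1 / (sqrt (real T) * (real d)\<^sup>2)"
        by (rule contraction_power_le[OF \<open>0 \<le> \<rho>\<close> \<open>\<rho> < 1\<close> T d K steps])
      also have "\<dots> \<le> (\<kappa> t)\<^sup>2"
        unfolding \<kappa>2 using that d
        by (intro divide_left_mono mult_mono) (auto simp: power2_eq_square)
      finally have "E0 * \<rho> ^ K \<le> E0 * (\<kappa> t)\<^sup>2"
        using E0 by (rule mult_left_mono)
      then show ?thesis
        by (simp add: \<epsilon>_def E0_def mult_ac)
    qed
    define g where "g t = (\<integral>v. (norm (grad d F (leader v t)))\<^sup>2 \<partial>directions d T)" for t
    have round: "\<eta> t * real d * (lh * \<delta> t + \<epsilon> / \<delta> t)\<^sup>2 / 2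
        + lh * (\<eta> t * real d * (Lh + \<epsilon> / \<delta> t))\<^sup>2 \<le> c1 * (1 / real (t + 1))" if t: "t < T" for t
    proof -
      have "\<eta> t * real d * (lh * \<delta> t + \<epsilon> / \<delta> t)\<^sup>2 / 2
          + lh * (\<eta> t * real d * (Lh + \<epsilon> / \<delta> t))\<^sup>2 \<le> c1 * (real d * (\<kappa> t)\<^sup>2)\<^sup>2"
        unfolding c1_def \<eta>_eq \<delta>_eq
        by (rule descent_remainder_le[OF lh0 Lh0 d \<open>\<eta>b > 0\<close> \<open>\<delta>b > 0\<close> \<kappa>_pos \<kappa>_le \<epsilon>0 \<epsilon>_le[OF t]])
      also have "(real d * (\<kappa> t)\<^sup>2)\<^sup>2 = 1 / real (t + 1)"
        using d by (simp add: \<kappa>2 power_divide)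
      finally show ?thesis .
    qed
    have "(\<Sum>t<T. \<eta> t * g t) / 2
        \<le> \<Delta> + (\<Sum>t<T. \<eta> t * real d * (lh * \<delta> t + \<epsilon> / \<delta> t)\<^sup>2 / 2
                + lh * (\<eta> t * real d * (Lh + \<epsilon> / \<delta> t))\<^sup>2)"
      unfolding g_def
    proof (rule sum_expected_grad_sq_le[OF F L \<delta>_pos \<eta>_pos])
      fix v :: "nat \<Rightarrow> fseq" and t
      assume "\<And>s. s \<le> t \<Longrightarrow> v s \<in> sphere 0 1 \<inter> euc d"
      then show "\<bar>payoff_diff v t - (F (leader v t + \<delta> t *\<^sub>R v t) - F (leader v t))\<bar> \<le> \<epsilon>"
        by (rule err)
    next
      fix x
      assume "x \<in> euc d"
      then show "F x0 - F x \<le> \<Delta>"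
        using gap unfolding F_def by blast
    qed
    also have "\<dots> \<le> \<Delta> + (\<Sum>t<T. c1 * (1 / real (t + 1)))"
      by (intro add_left_mono sum_mono round) simp
    also have "\<dots> = \<Delta> + c1 * (\<Sum>t<T. 1 / real (t + 1))"
      by (simp add: sum_distrib_left)
    also have "\<dots> \<le> \<Delta> * (1 + ln (real T)) + c1 * (1 + ln (real T))"
      using sum_inverse_le_ln[OF T] c1 \<Delta>0 T
      by (intro add_mono mult_left_mono) (simp_all add: distrib_left)
    finally have upper: "(\<Sum>t<T. \<eta> t * g t) \<le> 2 * (\<Delta> + c1) * (1 + ln (real T))"
      by (simp add: algebra_simps)
    \<comment> \<open>Only the rounds \<open>t < T\<close> enter the average: no step is taken from the last point.\<close>
    define m where "m = Min (g ` {0..T})"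
    have m_le: "m \<le> g t" if "t < T" for t
      unfolding m_def using that by (intro Min_le) auto
    have "m \<in> g ` {0..T}"
      unfolding m_def by (intro Min_in) auto
    then have m0: "m \<ge> 0"
      by (auto simp: g_def)
    have "\<eta>b * (sqrt (real T) / real d) * m = (\<Sum>t<T. \<eta>b / (sqrt (real T) * real d) * m)"
    proof -
      have "(\<Sum>t<T. \<eta>b / (sqrt (real T) * real d) * m)
          = real T / sqrt (real T) * (\<eta>b * m / real d)"
        by simp
      then show ?thesis
        by (simp only: real_div_sqrt) simp
    qed
    also have "\<dots> \<le> (\<Sum>t<T. \<eta> t * g t)"
    proof (intro sum_mono mult_mono)
      fix t
      assume t: "t \<in> {..<T}"
      have "\<eta>b / (sqrt (real T) * real d) \<le> \<eta>b / (sqrt (real (t + 1)) * real d)"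
        using t d \<open>\<eta>b > 0\<close> by (intro divide_left_mono mult_right_mono) auto
      then show "\<eta>b / (sqrt (real T) * real d) \<le> \<eta> t"
        by (simp add: \<eta>_eq \<kappa>2)
    qed (use m_le m0 \<eta>_pos in auto)
    also note upper
    finally have "m * (\<eta>b * (sqrt (real T) / real d)) \<le> 2 * (\<Delta> + c1) * (1 + ln (real T))"
      by (simp only: mult.commute)
    moreover have "\<eta>b * (sqrt (real T) / real d) > 0"
      using T d \<open>\<eta>b > 0\<close> by simp
    ultimately have "m \<le> 2 * (\<Delta> + c1) * (1 + ln (real T)) / (\<eta>b * (sqrt (real T) / real d))"
      by (simp only: pos_le_divide_eq)
    then have "m \<le> 2 * (\<Delta> + c1) / \<eta>b * (1 + ln (real T)) * (real d / sqrt (real T))"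
      by simp
    then show ?case
      unfolding Let_def \<eta>_def[symmetric] \<delta>_def[symmetric] F_def[symmetric]
      by (simp add: m_def g_def[abs_def] leader_def iterate_def)
  qed
qed

end
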